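(* On the Inoue surfaces $\mathcal{S}^+_{N,p,q,r,0}$ and $\mathcal{S}^-_{N,p,q,r}$ there exist no LCK metrics which are $d_\theta$-exact; that is, there is no LCK metric with fundamental form $\omega$ and Lee form $\theta$ such that $\omega=d\eta-\theta\wedge\eta$ for some one-form $\eta$.
   Context: LCK metrics: a Hermitian metric $g$ on a complex manifold $(M,J)$, with fundamental two-form $\omega(X,Y)=g(JX,Y)$, is locally conformally Kähler (LCK) if there is a closed one-form $\theta$ (its Lee form) with $d\omega=\theta\wedge\omega$. For a closed one-form $\theta$, $d_\theta=d-\theta\wedge\cdot$; the metric is called $d_\theta$-exact if $\omega$ is $d_\theta$-exact. Inoue surfaces (with the complex structure inherited from $\mathbb{C}\times\mathbb{H}$, $\mathbb{H}$ the upper half-plane): $\mathcal{S}^+_{N,p,q,r,0}$: let $N=(n_{ij})\in\mathrm{SL}_2(\mathbb{Z})$ have real eigenvalues $\alpha>1$ and $1/\alpha$, with real eigenvectors $(a_1,a_2)^t$ and $(b_1,b_2)^t$ respectively; fix integers $p,q,r$, $r\ne0$. Put $e_i=\tfrac12 n_{i1}(n_{i1}-1)a_1b_1+\tfrac12 n_{i2}(n_{i2}-1)a_2b_2+n_{i1}n_{i2}b_1a_2$ ($i=1,2$) and define $c_1,c_2$ by $(c_1,c_2)=(c_1,c_2)N^t+(e_1,e_2)+\frac{b_1a_2-b_2a_1}{r}(p,q)$. On $\mathbb{C}\times\mathbb{H}\cong\mathbb{R}^3\times\mathbb{R}^+$, with complex coordinates $(x+\mathrm{i}y,\,w+\mathrm{i}t)$,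 $t>0$, let $G^+_{N,p,q,r,0}$ be generated by $g_0(x,y,w,t)=(x,y,\alpha w,\alpha t)$, $g_i(x,y,w,t)=(x+b_iw+c_i,y+b_it,w+a_i,t)$ for $i=1,2$, and $g_3(x,y,w,t)=(x+\frac{b_1a_2-b_2a_1}{r},y,w,t)$. Then $\mathcal{S}^+_{N,p,q,r,0}$ is the quotient by $G^+_{N,p,q,r,0}$. $\mathcal{S}^-_{N,p,q,r}$: let $N=(n_{ij})\in\mathrm{GL}_2(\mathbb{Z})$, $\det N=-1$, with eigenvalues $\alpha>1$ and $-1/\alpha$ and corresponding real eigenvectors $(a_1,a_2)^t$ and $(b_1,b_2)^t$; fix integers $p,q,r$, $r\neq0$; let $e_1,e_2$ be given by the same formula as for $\mathcal{S}^+$, and $c_1,c_2$ by $-(c_1,c_2)=(c_1,c_2)N^t+(e_1,e_2)+\frac{b_1a_2-b_2a_1}{r}(p,q)$. Then $\mathcal{S}^-_{N,p,q,r}$ is the quotient of $\mathbb{C}\times\mathbb{H}$ by the group generated by $g_0(x,y,w,t)=(-x,-y,\alpha w,\alpha t)$ and $g_1,g_2,g_3$ given by the same formulas as for $\mathcal{S}^+$. *)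

theory Defs
  imports
    "HOL-Analysis.Analysis"
    "HOL-Algebra.Group_Action"
    "HOL-Algebra.Generated_Groups"
begin

section \<open>Smooth functions and exterior calculus on open subsets of \<open>\<complex>\<^sup>2\<close>\<close>

type_synonym c2 = "complex \<times> complex"

text \<open>\<open>Ck_on k S f\<close> means that \<open>f\<close> is \<open>k\<close> times continuously (real) differentiable;
  \<open>S\<close> is meant to be open.\<close>

primrec Ck_on :: "nat \<Rightarrow> 'a::real_normed_vector set \<Rightarrow> ('a \<Rightarrow> real) \<Rightarrow> bool" where
  "Ck_on 0 S f \<longleftrightarrow> continuous_on S f"
| "Ck_on (Suc k) S f \<longleftrightarrow>
     (\<forall>x\<in>S. f differentiable (at x)) \<and>
     (\<forall>v. Ck_on k S (\<lambda>x. frechet_derivative f (at x) v))"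

definition smooth_on :: "'a::real_normed_vector set \<Rightarrow> ('a \<Rightarrow> real) \<Rightarrow> bool" where
  "smooth_on S f \<longleftrightarrow> (\<forall>k. Ck_on k S f)"

text \<open>A differential form on an open subset of \<open>\<complex>\<^sup>2 = \<real>\<^sup>4\<close> is a function of the base point and of
  one, two or three real tangent vectors. Exterior derivative and wedge product follow the
  convention without factorials, \<open>d\<eta>(u,v) = u(\<eta>(v)) - v(\<eta>(u))\<close> for constant vector fields
  \<open>u\<close>, \<open>v\<close>, and \<open>(\<theta> \<and> \<eta>)(u,v) = \<theta>(u) \<eta>(v) - \<theta>(v) \<eta>(u)\<close>.\<close>

definition ext_d1 :: "(c2 \<Rightarrow> c2 \<Rightarrow> real) \<Rightarrow> c2 \<Rightarrow> c2 \<Rightarrow> c2 \<Rightarrow> real" where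
  "ext_d1 \<eta> x u v =
     frechet_derivative (\<lambda>y. \<eta> y v) (at x) u - frechet_derivative (\<lambda>y. \<eta> y u) (at x) v"

definition ext_d2 :: "(c2 \<Rightarrow> c2 \<Rightarrow> c2 \<Rightarrow> real) \<Rightarrow> c2 \<Rightarrow> c2 \<Rightarrow> c2 \<Rightarrow> c2 \<Rightarrow> real" where
  "ext_d2 \<omega> x u v w =
     frechet_derivative (\<lambda>y. \<omega> y v w) (at x) u
   - frechet_derivative (\<lambda>y. \<omega> y u w) (at x) v
   + frechet_derivative (\<lambda>y. \<omega> y u v) (at x) w"

definition wedge11 :: "(c2 \<Rightarrow> real) \<Rightarrow> (c2 \<Rightarrow> real) \<Rightarrow> c2 \<Rightarrow> c2 \<Rightarrow> real" where
  "wedge11 \<theta> \<eta> u v = \<theta> u * \<eta> v - \<theta> v * \<eta> u"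

definition wedge12 :: "(c2 \<Rightarrow> real) \<Rightarrow> (c2 \<Rightarrow> c2 \<Rightarrow> real) \<Rightarrow> c2 \<Rightarrow> c2 \<Rightarrow> c2 \<Rightarrow> real" where
  "wedge12 \<theta> \<omega> u v w = \<theta> u * \<omega> v w - \<theta> v * \<omega> u w + \<theta> w * \<omega> u v"


section \<open>Tensor fields and LCK metrics on complex surfaces\<close>

text \<open>A complex surface is given by a holomorphic atlas; its underlying set is the union of the
  domains of the charts. A chart is a pair of a domain and a coordinate map (only the values on
  the domain are relevant).\<close>

type_synonym 'm chart = "'m set \<times> ('m \<Rightarrow> c2)"

definition chart_image :: "'m chart \<Rightarrow> c2 set" where
  "chart_image \<kappa> = snd \<kappa> ` fst \<kappa>"

definition overlap :: "'m chart \<Rightarrow> 'm chart \<Rightarrow> c2 set" where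
  "overlap \<kappa> \<kappa>' = snd \<kappa> ` (fst \<kappa> \<inter> fst \<kappa>')"

definition transition :: "'m chart \<Rightarrow> 'm chart \<Rightarrow> c2 \<Rightarrow> c2" where
  "transition \<kappa> \<kappa>' = snd \<kappa>' \<circ> inv_into (fst \<kappa>) (snd \<kappa>)"

text \<open>A tensor field on the surface is the family of its coordinate representations, indexed by
  the charts: the representations in two charts are related on the overlap by pulling back along
  the transition map.\<close>

definition smooth_one_form :: "'m chart set \<Rightarrow> ('m chart \<Rightarrow> c2 \<Rightarrow> c2 \<Rightarrow> real) \<Rightarrow> bool" where
  "smooth_one_form A \<eta> \<longleftrightarrow>
     (\<forall>\<kappa>\<in>A. (\<forall>x\<in>chart_image \<kappa>. linear (\<eta> \<kappa> x)) \<and>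
             (\<forall>v. smooth_on (chart_image \<kappa>) (\<lambda>x. \<eta> \<kappa> x v))) \<and>
     (\<forall>\<kappa>\<in>A. \<forall>\<kappa>'\<in>A. \<forall>x\<in>overlap \<kappa> \<kappa>'. \<forall>v.
        \<eta> \<kappa> x v =
        \<eta> \<kappa>' (transition \<kappa> \<kappa>' x) (frechet_derivative (transition \<kappa> \<kappa>') (at x) v))"

definition smooth_cov2_tensor ::
    "'m chart set \<Rightarrow> ('m chart \<Rightarrow> c2 \<Rightarrow> c2 \<Rightarrow> c2 \<Rightarrow> real) \<Rightarrow> bool" where
  "smooth_cov2_tensor A g \<longleftrightarrow>
     (\<forall>\<kappa>\<in>A. (\<forall>x\<in>chart_image \<kappa>. bilinear (g \<kappa> x)) \<and>
             (\<forall>u v. smooth_on (chart_image \<kappa>) (\<lambda>x. g \<kappa> x u v))) \<and>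
     (\<forall>\<kappa>\<in>A. \<forall>\<kappa>'\<in>A. \<forall>x\<in>overlap \<kappa> \<kappa>'. \<forall>u v.
        g \<kappa> x u v =
        g \<kappa>' (transition \<kappa> \<kappa>' x)
          (frechet_derivative (transition \<kappa> \<kappa>') (at x) u)
          (frechet_derivative (transition \<kappa> \<kappa>') (at x) v))"

text \<open>The complex structure in holomorphic coordinates: multiplication of tangent vectors by
  \<open>\<i>\<close>.\<close>

definition cstr :: "c2 \<Rightarrow> c2" where
  "cstr v = (\<i> * fst v, \<i> * snd v)"

definition hermitian_metric ::
    "'m chart set \<Rightarrow> ('m chart \<Rightarrow> c2 \<Rightarrow> c2 \<Rightarrow> c2 \<Rightarrow> real) \<Rightarrow> bool" where
  "hermitian_metric A g \<longleftrightarrow>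
     smooth_cov2_tensor A g \<and>
     (\<forall>\<kappa>\<in>A. \<forall>x\<in>chart_image \<kappa>.
        (\<forall>u v. g \<kappa> x u v = g \<kappa> x v u) \<and>
        (\<forall>u. u \<noteq> 0 \<longrightarrow> 0 < g \<kappa> x u u) \<and>
        (\<forall>u v. g \<kappa> x (cstr u) (cstr v) = g \<kappa> x u v))"

definition fundamental_form ::
    "('m chart \<Rightarrow> c2 \<Rightarrow> c2 \<Rightarrow> c2 \<Rightarrow> real) \<Rightarrow> 'm chart \<Rightarrow> c2 \<Rightarrow> c2 \<Rightarrow> c2 \<Rightarrow> real" where
  "fundamental_form g = (\<lambda>\<kappa> x u v. g \<kappa> x (cstr u) v)"

definition closed_one_form :: "'m chart set \<Rightarrow> ('m chart \<Rightarrow> c2 \<Rightarrow> c2 \<Rightarrow> real) \<Rightarrow> bool" where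
  "closed_one_form A \<theta> \<longleftrightarrow>
     smooth_one_form A \<theta> \<and>
     (\<forall>\<kappa>\<in>A. \<forall>x\<in>chart_image \<kappa>. \<forall>u v. ext_d1 (\<theta> \<kappa>) x u v = 0)"

text \<open>\<open>g\<close> is an LCK metric with Lee form \<open>\<theta>\<close>.\<close>

definition lck_metric_with_lee_form ::
    "'m chart set \<Rightarrow> ('m chart \<Rightarrow> c2 \<Rightarrow> c2 \<Rightarrow> c2 \<Rightarrow> real) \<Rightarrow> ('m chart \<Rightarrow> c2 \<Rightarrow> c2 \<Rightarrow> real) \<Rightarrow> bool"
  where
  "lck_metric_with_lee_form A g \<theta> \<longleftrightarrow>
     hermitian_metric A g \<and> closed_one_form A \<theta> \<and>
     (\<forall>\<kappa>\<in>A. \<forall>x\<in>chart_image \<kappa>. \<forall>u v w.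
        ext_d2 (fundamental_form g \<kappa>) x u v w =
        wedge12 (\<theta> \<kappa> x) (fundamental_form g \<kappa> x) u v w)"

text \<open>\<open>\<omega> = d\<eta> - \<theta> \<and> \<eta>\<close> for some one-form \<open>\<eta>\<close>.\<close>

definition d_theta_exact ::
    "'m chart set \<Rightarrow> ('m chart \<Rightarrow> c2 \<Rightarrow> c2 \<Rightarrow> real) \<Rightarrow> ('m chart \<Rightarrow> c2 \<Rightarrow> c2 \<Rightarrow> c2 \<Rightarrow> real) \<Rightarrow> bool"
  where
  "d_theta_exact A \<theta> \<omega> \<longleftrightarrow>
     (\<exists>\<eta>. smooth_one_form A \<eta> \<and>
        (\<forall>\<kappa>\<in>A. \<forall>x\<in>chart_image \<kappa>. \<forall>u v.
           \<omega> \<kappa> x u v = ext_d1 (\<eta> \<kappa>) x u v - wedge11 (\<theta> \<kappa> x) (\<eta> \<kappa> x) u v))"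


section \<open>Quotients of open subsets of \<open>\<complex>\<^sup>2\<close>\<close>

text \<open>The group of transformations of \<open>X\<close> generated by a set of bijections of \<open>X\<close>
  (elements of \<open>BijGroup X\<close> are extensional, hence the restriction).\<close>

definition transformation_group :: "c2 set \<Rightarrow> (c2 \<Rightarrow> c2) set \<Rightarrow> (c2 \<Rightarrow> c2) monoid" where
  "transformation_group X F =
     (BijGroup X)\<lparr>carrier := generate (BijGroup X) ((\<lambda>f. restrict f X) ` F)\<rparr>"

text \<open>The points of the quotient are the orbits; the charts are the inverses of the restrictions
  of the projection to the open sets on which it is injective. For a free and properly
  discontinuous holomorphic action this is a holomorphic atlas of the quotient, with the complex
  structure inherited from \<open>X\<close>.\<close>

definition quotient_atlas :: "c2 set \<Rightarrow> (c2 \<Rightarrow> c2) monoid \<Rightarrow> c2 set chart set" where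
  "quotient_atlas X G =
     {(orbit G id ` U, inv_into U (orbit G id)) | U.
        open U \<and> U \<subseteq> X \<and> inj_on (orbit G id) U}"


section \<open>The Inoue surfaces\<close>

definition CH :: "c2 set" where
  "CH = UNIV \<times> {z. Im z > 0}"

text \<open>A point of \<open>CH\<close> is \<open>(x + \<i> y, w + \<i> t)\<close>.\<close>

definition g0_plus :: "real \<Rightarrow> c2 \<Rightarrow> c2" where
  "g0_plus \<alpha> = (\<lambda>(z, \<zeta>). (Complex (Re z) (Im z), Complex (\<alpha> * Re \<zeta>) (\<alpha> * Im \<zeta>)))"

definition g0_minus :: "real \<Rightarrow> c2 \<Rightarrow> c2" where
  "g0_minus \<alpha> = (\<lambda>(z, \<zeta>). (Complex (- Re z) (- Im z), Complex (\<alpha> * Re \<zeta>) (\<alpha> * Im \<zeta>)))"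

definition g12 :: "real^2 \<Rightarrow> real^2 \<Rightarrow> real^2 \<Rightarrow> 2 \<Rightarrow> c2 \<Rightarrow> c2" where
  "g12 a b c i =
     (\<lambda>(z, \<zeta>). (Complex (Re z + b$i * Re \<zeta> + c$i) (Im z + b$i * Im \<zeta>),
                 Complex (Re \<zeta> + a$i) (Im \<zeta>)))"

definition g3 :: "real^2 \<Rightarrow> real^2 \<Rightarrow> int \<Rightarrow> c2 \<Rightarrow> c2" where
  "g3 a b r =
     (\<lambda>(z, \<zeta>). (Complex (Re z + (b$1 * a$2 - b$2 * a$1) / of_int r) (Im z),
                 Complex (Re \<zeta>) (Im \<zeta>)))"

definition real_mat :: "int^2^2 \<Rightarrow> real^2^2" where
  "real_mat N = map_matrix of_int N"

definition inoue_e :: "int^2^2 \<Rightarrow> real^2 \<Rightarrow> real^2 \<Rightarrow> real^2" where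
  "inoue_e N a b =
     (\<chi> i. let n1 = of_int (N$i$1) :: real; n2 = of_int (N$i$2) :: real in
       1/2 * n1 * (n1 - 1) * a$1 * b$1 + 1/2 * n2 * (n2 - 1) * a$2 * b$2 + n1 * n2 * b$1 * a$2)"

definition inoue_shift :: "real^2 \<Rightarrow> real^2 \<Rightarrow> int \<Rightarrow> int \<Rightarrow> int \<Rightarrow> real^2" where
  "inoue_shift a b p q r =
     ((b$1 * a$2 - b$2 * a$1) / of_int r) *\<^sub>R vector [of_int p, of_int q]"

text \<open>The admissible data for \<open>S\<^sup>+\<close> and \<open>S\<^sup>-\<close>: \<open>a\<close>, \<open>b\<close> are eigenvectors of \<open>N\<close> (acting on
  columns), while the equation for \<open>c\<close> is one between row vectors.\<close>

definition inoue_plus_data ::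
    "int^2^2 \<Rightarrow> real \<Rightarrow> real^2 \<Rightarrow> real^2 \<Rightarrow> real^2 \<Rightarrow> int \<Rightarrow> int \<Rightarrow> int \<Rightarrow> bool" where
  "inoue_plus_data N \<alpha> a b c p q r \<longleftrightarrow>
     det N = 1 \<and> \<alpha> > 1 \<and>
     a \<noteq> 0 \<and> real_mat N *v a = \<alpha> *\<^sub>R a \<and>
     b \<noteq> 0 \<and> real_mat N *v b = (1 / \<alpha>) *\<^sub>R b \<and>
     r \<noteq> 0 \<and>
     c = c v* transpose (real_mat N) + inoue_e N a b + inoue_shift a b p q r"

definition inoue_minus_data ::
    "int^2^2 \<Rightarrow> real \<Rightarrow> real^2 \<Rightarrow> real^2 \<Rightarrow> real^2 \<Rightarrow> int \<Rightarrow> int \<Rightarrow> int \<Rightarrow> bool" where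
  "inoue_minus_data N \<alpha> a b c p q r \<longleftrightarrow>
     det N = -1 \<and> \<alpha> > 1 \<and>
     a \<noteq> 0 \<and> real_mat N *v a = \<alpha> *\<^sub>R a \<and>
     b \<noteq> 0 \<and> real_mat N *v b = (- 1 / \<alpha>) *\<^sub>R b \<and>
     r \<noteq> 0 \<and>
     - c = c v* transpose (real_mat N) + inoue_e N a b + inoue_shift a b p q r"

definition inoue_plus ::
    "real \<Rightarrow> real^2 \<Rightarrow> real^2 \<Rightarrow> real^2 \<Rightarrow> int \<Rightarrow> c2 set chart set" where
  "inoue_plus \<alpha> a b c r =
     quotient_atlas CH
       (transformation_group CH {g0_plus \<alpha>, g12 a b c 1, g12 a b c 2, g3 a b r})"

definition inoue_minus ::
    "real \<Rightarrow> real^2 \<Rightarrow> real^2 \<Rightarrow> real^2 \<Rightarrow> int \<Rightarrow> c2 set chart set" where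
  "inoue_minus \<alpha> a b c r =
     quotient_atlas CH
       (transformation_group CH {g0_minus \<alpha>, g12 a b c 1, g12 a b c 2, g3 a b r})"

end

theory Submission
  imports Defs
begin

text \<open>Suppose that \<open>g\<close> is such a metric, with \<open>\<omega> = d\<eta> - \<theta> \<and> \<eta>\<close>, and pull \<open>\<theta>\<close> and \<open>\<eta>\<close> back to
  \<open>\<complex> \<times> \<H>\<close>, with real coordinates \<open>(x, y, w, t)\<close>. The cover is convex, so \<open>\<theta> = df\<close>
  (\<open>closed_one_form_exact_on_convex\<close>) and \<open>d(e\<^sup>-\<^sup>f \<eta>) = e\<^sup>-\<^sup>f \<omega>\<close>. As \<open>\<theta>\<close> is invariant, \<open>f \<circ> \<gamma> - f\<close>
  is a constant for every deck transformation \<open>\<gamma>\<close>, which gives a homomorphism from the group to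
  \<open>\<real>\<close>. It vanishes on the lattice \<open>\<langle>g\<^sub>1, g\<^sub>2, g\<^sub>3\<rangle>\<close> of the Heisenberg group
  (\<open>lattice_character_trivial\<close>): a power of \<open>g\<^sub>3\<close> is a commutator, and modulo \<open>g\<^sub>3\<close> conjugation
  by \<open>g\<^sub>0\<close> acts on \<open>g\<^sub>1, g\<^sub>2\<close> by the matrix \<open>N\<close>, which does not have the eigenvalue \<open>1\<close>.
  So \<open>e\<^sup>-\<^sup>f \<eta>\<close> is invariant under the lattice.

  The lattice also fixes the vector fields \<open>\<partial>\<^sub>x\<close> and \<open>\<partial>\<^sub>y = J \<partial>\<^sub>x\<close>. Hence \<open>K = e\<^sup>-\<^sup>f \<eta>(\<partial>\<^sub>x)\<close> and
  \<open>F = e\<^sup>-\<^sup>f \<eta>(\<partial>\<^sub>y)\<close> are lattice invariant functions with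
  \<open>\<partial>\<^sub>x F - \<partial>\<^sub>y K = e\<^sup>-\<^sup>f \<omega>(\<partial>\<^sub>x, \<partial>\<^sub>y) = e\<^sup>-\<^sup>f g(\<partial>\<^sub>y, \<partial>\<^sub>y) > 0\<close>. But the lattice acts on the slice
  \<open>t = 1\<close> with compact quotient and preserves \<open>dx dy dw\<close>, and the integral of a divergence over a
  compact quotient is zero (\<open>lattice_invariant_divergence_not_positive\<close>).

  To pull forms back, the cover must be covered by chart domains of the quotient, that is, the
  action must be free and properly discontinuous (\<open>wandering_neighbourhood\<close>). This rests on the
  equation that defines \<open>c\<close>: it says that \<open>g\<^sub>0\<close> normalises the lattice (\<open>dil_lat\<close>, \<open>lat_dil\<close>), so
  that every group element is a power of \<open>g\<^sub>0\<close> times a lattice element.\<close>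

section \<open>Closed one-forms and periodic functions\<close>

lemma continuous_on_Pair_const: "continuous_on A (Pair c)"
  using continuous_on_Pair[OF continuous_on_const continuous_on_id, of A c] by simp

text \<open>The Poincare lemma: the primitive is the integral of \<open>\<theta>\<close> along the segment from a base point.
  Closedness turns its derivative in direction \<open>h\<close>, computed under the integral sign, into the
  integral of the total derivative of \<open>s \<theta>(p\<^sub>s)(h)\<close>, where \<open>p\<^sub>s\<close> runs through the segment.\<close>

lemma closed_one_form_exact_on_convex:
  fixes S :: "'a::euclidean_space set" and \<theta> :: "'a \<Rightarrow> 'a \<Rightarrow> real"
    and d :: "'a \<Rightarrow> 'a \<Rightarrow> 'a \<Rightarrow> real"
  assumes "convex S"
    and lin: "\<And>x. x \<in> S \<Longrightarrow> linear (\<theta> x)"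
    and der: "\<And>x v. x \<in> S \<Longrightarrow> ((\<lambda>y. \<theta> y v) has_derivative d v x) (at x)"
    and cont: "\<And>u v. continuous_on S (\<lambda>x. d v x u)"
    and closed: "\<And>x u v. x \<in> S \<Longrightarrow> d v x u = d u x v"
  shows "\<exists>f. \<forall>x\<in>S. (f has_derivative \<theta> x) (at x within S)"
proof (cases "S = {}")
  case False
  then obtain x0 where x0: "x0 \<in> S" by auto
  define p where "p = (\<lambda>x (s::real). x0 + s *\<^sub>R (x - x0))"
  have pS: "p x s \<in> S" if "x \<in> S" "s \<in> {0..1}" for x s
  proof -
    have "p x s = (1 - s) *\<^sub>R x0 + s *\<^sub>R x" by (simp add: p_def algebra_simps)
    then show ?thesis using \<open>convex S\<close> x0 that unfolding convex_alt by auto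
  qed
  have cont_p: "continuous_on (S \<times> {0..1}) (\<lambda>z. p (fst z) (snd z))"
    unfolding p_def by (intro continuous_intros)
  have cont\<theta>: "continuous_on S (\<lambda>x. \<theta> x v)" for v
    using der[THEN has_derivative_continuous] continuous_at_imp_continuous_on by blast
  \<comment> \<open>The integrand \<open>\<theta>(p\<^sub>s)(x - x0)\<close>, in coordinates so that both dependences on \<open>x\<close> can be
    differentiated; \<open>D\<close> is its derivative.\<close>
  define g where "g = (\<lambda>x s. \<Sum>i\<in>Basis. ((x - x0) \<bullet> i) * \<theta> (p x s) i)"
  define D where "D = (\<lambda>x s h. \<Sum>i\<in>Basis. (h \<bullet> i) * \<theta> (p x s) i
                                + ((x - x0) \<bullet> i) * d i (p x s) (s *\<^sub>R h))"
  have dbl: "bounded_linear (d v x)" if "x \<in> S" for v x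
    using der[OF that] has_derivative_bounded_linear by blast
  have g_der: "((\<lambda>x. g x s) has_derivative D x s) (at x within S)"
    if "x \<in> S" "s \<in> {0..1}" for x s
  proof -
    have 1: "((\<lambda>x. p x s) has_derivative (\<lambda>h. s *\<^sub>R h)) (at x within S)"
      unfolding p_def by (auto intro!: derivative_eq_intros)
    have 2: "((\<lambda>x. \<theta> (p x s) i) has_derivative (\<lambda>h. d i (p x s) (s *\<^sub>R h))) (at x within S)" for i
      using has_derivative_compose[OF 1 der[OF pS[OF that]]] by simp
    show ?thesis unfolding g_def D_def
      by (rule has_derivative_eq_rhs) (auto intro!: derivative_eq_intros 2 simp: algebra_simps sum.distrib)
  qed
  have D_bl: "bounded_linear (D x s)" if "x \<in> S" "s \<in> {0..1}" for x s
    using g_der[OF that] has_derivative_bounded_linear by blast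
  define B where "B = (\<lambda>x s. Blinfun (D x s))"
  have B: "blinfun_apply (B x s) = D x s" if "x \<in> S" "s \<in> {0..1}" for x s
    unfolding B_def using D_bl[OF that] by (rule bounded_linear_Blinfun_apply)
  have cont_comp: "continuous_on (S \<times> {0..1}) (\<lambda>z. k (p (fst z) (snd z)))"
    if "continuous_on S k" for k :: "'a \<Rightarrow> real"
    by (rule continuous_on_compose2[OF that cont_p]) (use pS in auto)
  have D_eq: "D x s h = (\<Sum>i\<in>Basis. (h \<bullet> i) * \<theta> (p x s) i + ((x - x0) \<bullet> i) * (s * d i (p x s) h))"
    if "x \<in> S" "s \<in> {0..1}" for x s h
    using dbl[OF pS[OF that]] by (simp add: D_def linear_simps)
  have contD: "continuous_on (S \<times> {0..1}) (\<lambda>z. D (fst z) (snd z) h)" for h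
  proof -
    have "continuous_on (S \<times> {0..1}) (\<lambda>z. \<Sum>i\<in>Basis. (h \<bullet> i) * \<theta> (p (fst z) (snd z)) i
             + ((fst z - x0) \<bullet> i) * (snd z * d i (p (fst z) (snd z)) h))"
      by (intro continuous_intros cont_comp cont\<theta> cont)
    then show ?thesis
      by (rule continuous_on_eq) (auto simp: D_eq)
  qed
  have contB: "continuous_on (S \<times> cbox 0 1) (\<lambda>(x, s). B x s)"
    unfolding split_beta
  proof (rule continuous_on_blinfun_componentwise)
    fix i :: 'a
    show "continuous_on (S \<times> cbox 0 1) (\<lambda>z. blinfun_apply (B (fst z) (snd z)) i)"
      using contD[of i] unfolding cbox_interval by (rule continuous_on_eq) (auto simp: B)
  qed
  have contg: "continuous_on {0..1} (g x)" if "x \<in> S" for x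
  proof -
    have "continuous_on {0..1} (\<lambda>s. p x s)" unfolding p_def by (intro continuous_intros)
    then have "continuous_on {0..1} (\<lambda>s. \<theta> (p x s) i)" for i
      by (rule continuous_on_compose2[OF cont\<theta>]) (use pS that in auto)
    then show ?thesis unfolding g_def by (intro continuous_intros)
  qed
  define f where "f = (\<lambda>x. integral (cbox 0 1) (g x))"
  have "(f has_derivative \<theta> x) (at x within S)" if x: "x \<in> S" for x
  proof -
    have L: "(f has_derivative integral (cbox 0 1) (B x)) (at x within S)"
      unfolding f_def
    proof (rule leibniz_rule[OF _ _ contB x \<open>convex S\<close>])
      fix y s assume "y \<in> S" "s \<in> cbox (0::real) 1"
      then show "((\<lambda>x. g x s) has_derivative blinfun_apply (B y s)) (at y within S)"
        using g_der B by simp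
    next
      fix y assume "y \<in> S"
      then show "g y integrable_on cbox 0 1"
        using contg by (simp add: integrable_continuous_real)
    qed
    have "blinfun_apply (integral (cbox 0 1) (B x)) h = \<theta> x h" for h
    proof -
      have "continuous_on (cbox 0 1) (B x)"
        using continuous_on_compose2[OF contB, of "cbox 0 1" "\<lambda>s. (x, s)"] x
        by (auto intro!: continuous_on_Pair_const)
      then have "blinfun_apply (integral (cbox 0 1) (B x)) h = integral (cbox 0 1) (\<lambda>s. B x s h)"
        using integral_linear[of "B x" "cbox 0 1" "\<lambda>b. blinfun_apply b h"]
        by (simp add: integrable_continuous_real blinfun.bounded_linear_left o_def)
      also have "\<dots> = integral {0..1} (\<lambda>s. D x s h)"
        using B[OF x] by (auto intro!: integral_cong)
      also have "\<dots> = 1 * \<theta> (p x 1) h - 0 * \<theta> (p x 0) h"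
      proof (rule integral_unique, rule fundamental_theorem_of_calculus)
        fix s :: real assume s: "s \<in> {0..1}"
        have 1: "((\<lambda>s. p x s) has_derivative (\<lambda>r. r *\<^sub>R (x - x0))) (at s within {0..1})"
          unfolding p_def by (auto intro!: derivative_eq_intros)
        have 2: "((\<lambda>s. \<theta> (p x s) h) has_derivative (\<lambda>r. d h (p x s) (r *\<^sub>R (x - x0)))) (at s within {0..1})"
          using has_derivative_compose[OF 1 der[OF pS[OF x s]]] by simp
        have "(\<Sum>i\<in>Basis. (h \<bullet> i) * \<theta> (p x s) i) = \<theta> (p x s) (\<Sum>i\<in>Basis. (h \<bullet> i) *\<^sub>R i)"
          using lin[OF pS[OF x s]] by (simp add: linear_sum linear_cmul)
        moreover have "(\<Sum>i\<in>Basis. ((x - x0) \<bullet> i) * d i (p x s) h)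
            = d h (p x s) (\<Sum>i\<in>Basis. ((x - x0) \<bullet> i) *\<^sub>R i)"
          using dbl[OF pS[OF x s]] closed[OF pS[OF x s]]
          by (simp add: linear_sum linear_cmul bounded_linear.linear)
        \<comment> \<open>Here closedness enters: the derivative of \<open>\<theta>(x - x0)\<close> in direction \<open>h\<close> becomes the
          derivative of \<open>\<theta>(h)\<close> in direction \<open>x - x0\<close>, which is a derivative in \<open>s\<close>.\<close>
        ultimately have Dh: "D x s h = \<theta> (p x s) h + s * d h (p x s) (x - x0)"
          using x s by (simp add: D_eq sum.distrib euclidean_representation mult.left_commute
              flip: sum_distrib_left)
        have dr: "d h (p x s) (r *\<^sub>R (x - x0)) = r * d h (p x s) (x - x0)" for r
          using dbl[OF pS[OF x s], of h] by (simp add: bounded_linear.linear linear_cmul)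
        show "((\<lambda>s. s * \<theta> (p x s) h) has_vector_derivative D x s h) (at s within {0..1})"
          unfolding has_vector_derivative_def
          by (rule has_derivative_eq_rhs, rule has_derivative_mult[OF has_derivative_ident 2])
             (simp add: Dh dr fun_eq_iff distrib_left mult.left_commute add.commute)
      qed simp
      also have "\<dots> = \<theta> x h" by (simp add: p_def)
      finally show ?thesis .
    qed
    then show ?thesis using L by (simp add: fun_eq_iff has_derivative_eq_rhs)
  qed
  then show ?thesis by blast
qed auto

lemma integral_periodic_shift_nonneg:
  fixes \<phi> :: "real \<Rightarrow> real"
  assumes "continuous_on UNIV \<phi>" "\<And>s. \<phi> (s + 1) = \<phi> s" "0 \<le> \<sigma>"
  shows "integral {0..1} (\<lambda>s. \<phi> (s + \<sigma>)) = integral {0..1} \<phi>"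
proof -
  have i: "\<phi> integrable_on {u..v}" for u v
    using assms(1) by (meson continuous_on_subset integrable_continuous_real subset_UNIV)
  have sh: "integral {u..v} (\<lambda>s. \<phi> (s + t)) = integral {u+t..v+t} \<phi>" for u v t
    using integral_shift_cbox_plus[of u v \<phi> t] by (simp add: o_def add.commute)
  have "integral {0..\<sigma>} \<phi> + integral {\<sigma>..\<sigma>+1} \<phi> = integral {0..\<sigma>+1} \<phi>"
    using assms by (intro Henstock_Kurzweil_Integration.integral_combine i) auto
  moreover have "integral {0..1} \<phi> + integral {1..\<sigma>+1} \<phi> = integral {0..\<sigma>+1} \<phi>"
    using assms by (intro Henstock_Kurzweil_Integration.integral_combine i) auto
  moreover have "integral {1..\<sigma>+1} \<phi> = integral {0..\<sigma>} \<phi>"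
    using sh[of 0 \<sigma> 1] assms(2) by simp
  moreover have "integral {0..1} (\<lambda>s. \<phi> (s + \<sigma>)) = integral {\<sigma>..\<sigma>+1} \<phi>"
    using sh[of 0 1 \<sigma>] by (simp add: add.commute)
  ultimately show ?thesis by simp
qed

lemma integral_periodic_shift:
  fixes \<phi> :: "real \<Rightarrow> real"
  assumes "continuous_on UNIV \<phi>" "\<And>s. \<phi> (s + 1) = \<phi> s"
  shows "integral {0..1} (\<lambda>s. \<phi> (s + \<sigma>)) = integral {0..1} \<phi>"
proof (cases "0 \<le> \<sigma>")
  case False
  have "continuous_on UNIV (\<lambda>s. \<phi> (s + \<sigma>))"
    by (rule continuous_on_compose2[OF assms(1)]) (auto intro!: continuous_intros)
  moreover have "\<phi> (s + 1 + \<sigma>) = \<phi> (s + \<sigma>)" for s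
    using assms(2)[of "s + \<sigma>"] by (simp add: algebra_simps)
  ultimately show ?thesis
    using integral_periodic_shift_nonneg[of "\<lambda>s. \<phi> (s + \<sigma>)" "- \<sigma>"] False by simp
qed (use assms integral_periodic_shift_nonneg in blast)

text \<open>A doubly periodic continuous function attains its maximum on a fundamental parallelogram, and
  there the partial derivative vanishes.\<close>

lemma doubly_periodic_partial_derivative_not_neg:
  fixes Q :: "real \<times> real \<Rightarrow> real"
  assumes cont: "continuous_on UNIV Q"
    and per1: "\<And>y w. Q (y + b1, w + a1) = Q (y, w)"
    and per2: "\<And>y w. Q (y + b2, w + a2) = Q (y, w)"
    and indep: "b1 * a2 - b2 * a1 \<noteq> 0"
    and der: "\<And>y w. ((\<lambda>y. Q (y, w)) has_real_derivative Q' y w) (at y)"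
    and neg: "\<And>y w. Q' y w < 0"
  shows False
proof -
  define e where "e = (\<lambda>(m::real, n::real). (m * b1 + n * b2, m * a1 + n * a2))"
  have per1n: "Q (y + of_int k * b1, w + of_int k * a1) = Q (y, w)" for k y w
  proof (induction k rule: int_induct[where k = 0])
    case (step1 i) then show ?case
      using per1[of "y + of_int i * b1" "w + of_int i * a1"] by (simp add: algebra_simps)
  next
    case (step2 i) then show ?case
      using per1[of "y + of_int (i-1) * b1" "w + of_int (i-1) * a1"] by (simp add: algebra_simps)
  qed simp
  have per2n: "Q (y + of_int k * b2, w + of_int k * a2) = Q (y, w)" for k y w
  proof (induction k rule: int_induct[where k = 0])
    case (step1 i) then show ?case
      using per2[of "y + of_int i * b2" "w + of_int i * a2"] by (simp add: algebra_simps)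
  next
    case (step2 i) then show ?case
      using per2[of "y + of_int (i-1) * b2" "w + of_int (i-1) * a2"] by (simp add: algebra_simps)
  qed simp
  have red: "\<exists>z\<in>e ` cbox (0,0) (1,1). Q (y, w) = Q z" for y w
  proof -
    define \<Delta> where "\<Delta> = b1 * a2 - b2 * a1"
    \<comment> \<open>Coordinates of \<open>(y, w)\<close> with respect to the periods, by Cramer's rule.\<close>
    define m where "m = (y * a2 - w * b2) / \<Delta>"
    define n where "n = (w * b1 - y * a1) / \<Delta>"
    have "\<Delta> \<noteq> 0" using indep by (simp add: \<Delta>_def)
    have "y = m * b1 + n * b2" "w = m * a1 + n * a2"
      using \<open>\<Delta> \<noteq> 0\<close> unfolding m_def n_def
      by (simp_all add: field_simps) (simp_all add: \<Delta>_def algebra_simps)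
    then have "(y, w) = (fst (e (frac m, frac n)) + of_int \<lfloor>m\<rfloor> * b1 + of_int \<lfloor>n\<rfloor> * b2,
                         snd (e (frac m, frac n)) + of_int \<lfloor>m\<rfloor> * a1 + of_int \<lfloor>n\<rfloor> * a2)"
      by (simp add: e_def frac_def algebra_simps)
    then have "Q (y, w) = Q (e (frac m, frac n))"
      using per1n per2n by (metis prod.collapse)
    moreover have "(frac m, frac n) \<in> cbox (0,0) (1,1)"
      by (simp add: less_imp_le frac_lt_1)
    ultimately show ?thesis by blast
  qed
  have "compact (e ` cbox (0,0) (1,1))"
    unfolding e_def split_beta by (intro compact_continuous_image compact_cbox continuous_intros)
  moreover have "e ` cbox (0,0) (1,1) \<noteq> {}"
    using red by blast
  ultimately obtain z where "z \<in> e ` cbox (0,0) (1,1)" and z: "\<forall>x\<in>e ` cbox (0,0) (1,1). Q x \<le> Q z"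
    using continuous_attains_sup[OF _ _ continuous_on_subset[OF cont]] by blast
  obtain y w where yw: "z = (y, w)" by force
  have "Q (y', w) \<le> Q (y, w)" for y'
    using red[of y' w] z yw by auto
  then have "Q' y w = 0"
    using DERIV_local_max[OF der[where w = w and y = y], of 1] by auto
  then show False using neg[of y w] by simp
qed

text \<open>The difference \<open>f \<circ> T - f\<close> is a primitive of \<open>T\<^sup>*\<theta> - \<theta> = 0\<close>.\<close>

lemma primitive_character:
  fixes \<theta> :: "c2 \<Rightarrow> c2 \<Rightarrow> real"
  assumes f: "\<And>x. x \<in> S \<Longrightarrow> (f has_derivative \<theta> x) (at x)" and "convex S"
    and T: "\<And>x. x \<in> S \<Longrightarrow> T x \<in> S" "\<And>x. x \<in> S \<Longrightarrow> (T has_derivative T') (at x)"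
    and inv: "\<And>x v. x \<in> S \<Longrightarrow> \<theta> (T x) (T' v) = \<theta> x v"
  shows "\<exists>\<kappa>::real. \<forall>x\<in>S. f (T x) = f x + \<kappa>"
proof -
  have "((\<lambda>x. f (T x) - f x) has_derivative (\<lambda>v. 0)) (at x within S)" if x: "x \<in> S" for x
    using has_derivative_diff[OF has_derivative_compose[OF T(2)[OF x] f[OF T(1)[OF x]]] f[OF x]]
    by (simp add: inv[OF x] has_derivative_at_withinI)
  then obtain \<kappa> where "\<forall>x\<in>S. f (T x) - f x = \<kappa>"
    using has_derivative_zero_constant[OF \<open>convex S\<close>] by blast
  then show ?thesis by (intro exI[of _ \<kappa>]) auto
qed

section \<open>One-forms on a quotient and on its cover\<close>

lemma Ck_on_cong:
  assumes "open S" "\<And>x. x \<in> S \<Longrightarrow> f x = g x" "Ck_on k S f"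
  shows "Ck_on k S g"
  using assms(2,3)
proof (induction k arbitrary: f g)
  case 0 then show ?case by (simp cong: continuous_on_cong)
next
  case (Suc k)
  have "g differentiable at x" and "frechet_derivative f (at x) = frechet_derivative g (at x)"
    if "x \<in> S" for x
  proof -
    have f: "f differentiable at x" using Suc.prems that by simp
    then show "g differentiable at x"
      using that Suc.prems(1) assms(1) unfolding differentiable_def
      by (meson has_derivative_transform_within_open)
    show "frechet_derivative f (at x) = frechet_derivative g (at x)"
      using f assms(1) that Suc.prems(1) by (rule frechet_derivative_transform_within_open)
  qed
  moreover have "Ck_on k S (\<lambda>x. frechet_derivative g (at x) v)" for v
    by (rule Suc.IH[of "\<lambda>x. frechet_derivative f (at x) v"]) (use calculation Suc.prems in auto)
  ultimately show ?case by simp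
qed

text \<open>Regularity is local, so a tensor field that is given by smooth pieces on chart domains is smooth.\<close>

lemma Ck_on_local:
  assumes "\<And>x. x \<in> S \<Longrightarrow> \<exists>U. open U \<and> x \<in> U \<and> U \<subseteq> S \<and> Ck_on k U f"
  shows "Ck_on k S f"
  using assms
proof (induction k arbitrary: f)
  case 0
  have "continuous (at x within S) f" if x: "x \<in> S" for x
  proof -
    obtain U where "open U" "x \<in> U" "continuous_on U f" using 0[OF x] by auto
    then show ?thesis
      by (meson continuous_at_imp_continuous_at_within continuous_on_eq_continuous_at)
  qed
  then show ?case by (simp add: continuous_on_eq_continuous_within)
next
  case (Suc k)
  have "f differentiable at x" if "x \<in> S" for x using Suc.prems[OF that] by auto
  moreover have "Ck_on k S (\<lambda>x. frechet_derivative f (at x) v)" for v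
  proof (rule Suc.IH)
    fix x assume "x \<in> S"
    then show "\<exists>U. open U \<and> x \<in> U \<and> U \<subseteq> S \<and> Ck_on k U (\<lambda>x. frechet_derivative f (at x) v)"
      using Suc.prems[of x] by auto
  qed
  ultimately show ?case by simp
qed

text \<open>The last assumption takes the place of freeness and proper discontinuity: each point has a
  neighbourhood in which no two distinct points are equivalent, which is what a chart needs.\<close>

locale covering_quotient =
  fixes X :: "c2 set" and F :: "(c2 \<Rightarrow> c2) set"
  assumes bij: "f \<in> F \<Longrightarrow> bij_betw f X X"
    and open_map: "f \<in> F \<Longrightarrow> open U \<Longrightarrow> U \<subseteq> X \<Longrightarrow> open (f ` U)"
    and wandering: "x \<in> X \<Longrightarrow> \<exists>U. open U \<and> x \<in> U \<and> U \<subseteq> X \<and>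
      (\<forall>u\<in>U. \<forall>h\<in>carrier (transformation_group X F). h u \<in> U \<longrightarrow> h u = u)"
begin

definition proj :: "c2 \<Rightarrow> c2 set" where
  "proj = orbit (transformation_group X F) id"

text \<open>The domains of the charts of the quotient, seen in the cover.\<close>

definition sheet :: "c2 set \<Rightarrow> bool" where
  "sheet U \<longleftrightarrow> open U \<and> U \<subseteq> X \<and> inj_on proj U"

definition sheet_chart :: "c2 set \<Rightarrow> c2 set chart" where
  "sheet_chart U = (proj ` U, inv_into U proj)"

lemma quotient_atlas_eq:
  "quotient_atlas X (transformation_group X F) = sheet_chart ` Collect sheet"
  unfolding quotient_atlas_def proj_def sheet_def sheet_chart_def by auto

lemma generators_subgroup:
  "subgroup (generate (BijGroup X) ((\<lambda>f. restrict f X) ` F)) (BijGroup X)"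
proof -
  interpret group "BijGroup X" by (rule group_BijGroup)
  have "(\<lambda>f. restrict f X) ` F \<subseteq> carrier (BijGroup X)"
    using bij by (auto simp: BijGroup_def Bij_def cong: bij_betw_cong)
  then show ?thesis by (rule generate_is_subgroup)
qed

lemma proj_generator:
  assumes "f \<in> F" "x \<in> X"
  shows "proj (f x) = proj x"
proof -
  interpret group "BijGroup X" by (rule group_BijGroup)
  define H where "H = generate (BijGroup X) ((\<lambda>f. restrict f X) ` F)"
  define f' where "f' = restrict f X"
  have f: "f' \<in> H" "inv\<^bsub>BijGroup X\<^esub> f' \<in> H"
    using assms(1) by (auto simp: H_def f'_def intro: generate.incl generate.inv)
  have mult: "h \<otimes>\<^bsub>BijGroup X\<^esub> k \<in> H" if "h \<in> H" "k \<in> H" for h k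
    using that unfolding H_def by (rule generate.eng)
  have HB: "h \<in> carrier (BijGroup X)" if "h \<in> H" for h
    using subgroup.subset[OF generators_subgroup] that unfolding H_def by blast
  have ap: "(h \<otimes>\<^bsub>BijGroup X\<^esub> f') x = h (f x)" if "h \<in> H" for h
    using HB[OF that] HB[OF f(1)] assms(2) by (simp add: BijGroup_def compose_def f'_def)
  have orb: "proj y = {h y |h. h \<in> H}" for y
    by (simp add: proj_def orbit_def transformation_group_def H_def)
  have "h (f x) \<in> proj x" if "h \<in> H" for h
    unfolding orb using ap[OF that] mult[OF that f(1)]
    by (intro CollectI exI[of _ "h \<otimes>\<^bsub>BijGroup X\<^esub> f'"]) simp
  moreover have "h x \<in> proj (f x)" if h: "h \<in> H" for h
  proof -
    define k where "k = h \<otimes>\<^bsub>BijGroup X\<^esub> inv\<^bsub>BijGroup X\<^esub> f'"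
    have k: "k \<in> H" unfolding k_def using h f(2) by (rule mult)
    have "k \<otimes>\<^bsub>BijGroup X\<^esub> f' = h"
      unfolding k_def using HB[OF h] HB[OF f(1)] by (simp add: m_assoc)
    then have "h x = k (f x)" using ap[OF k] by simp
    then show ?thesis using k unfolding orb by (intro CollectI exI[of _ k]) simp
  qed
  ultimately show ?thesis unfolding orb[of x] orb[of "f x"]
    by (intro equalityI subsetI; elim CollectE exE conjE; simp only:)
qed

lemma proj_eqD:
  assumes "proj x = proj y" "y \<in> X"
  shows "\<exists>h\<in>carrier (transformation_group X F). h x = y"
proof -
  have "\<one>\<^bsub>BijGroup X\<^esub> \<in> carrier (transformation_group X F)"
    by (simp add: transformation_group_def generate.one)
  moreover have "\<one>\<^bsub>BijGroup X\<^esub> y = y" using assms(2) by (simp add: BijGroup_def)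
  ultimately have "y \<in> proj y" unfolding proj_def orbit_def
    by (intro CollectI exI[of _ "\<one>\<^bsub>BijGroup X\<^esub>"]) simp
  then have "y \<in> proj x" using assms(1) by simp
  then show ?thesis unfolding proj_def orbit_def by (elim CollectE exE conjE) (auto intro: bexI)
qed

lemma sheet_exists:
  assumes "x \<in> X"
  shows "\<exists>U. sheet U \<and> x \<in> U"
proof -
  obtain U where U: "open U" "x \<in> U" "U \<subseteq> X"
    and fixed: "\<forall>u\<in>U. \<forall>h\<in>carrier (transformation_group X F). h u \<in> U \<longrightarrow> h u = u"
    using wandering[OF assms] by (elim exE conjE)
  have "inj_on proj U"
  proof (rule inj_onI)
    fix u v assume uv: "u \<in> U" "v \<in> U" "proj u = proj v"
    then obtain h where h: "h \<in> carrier (transformation_group X F)" "h u = v"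
      using proj_eqD[of u v] U(3) by (meson subsetD)
    then have "h u = u" using fixed[rule_format, OF uv(1) h(1)] uv(2) by simp
    then show "u = v" using h(2) by simp
  qed
  then show ?thesis using U by (intro exI[of _ U]) (simp add: sheet_def)
qed

lemma chart_image_sheet: "sheet U \<Longrightarrow> chart_image (sheet_chart U) = U"
  by (force simp: chart_image_def sheet_chart_def sheet_def image_image)

lemma transition_sheet:
  assumes "sheet U" "x \<in> U"
  shows "transition (sheet_chart U) (sheet_chart V) x = inv_into V proj (proj x)"
proof -
  have "inv_into (proj ` U) (inv_into U proj) (inv_into U proj (proj x)) = proj x"
    using assms(2) by (intro inv_into_f_f inj_on_inv_into) auto
  then show ?thesis using assms by (simp add: transition_def sheet_chart_def sheet_def)
qed

lemma transition_sheet_generator: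
  assumes "sheet U" "sheet V" "x \<in> U" "\<gamma> x \<in> V" "proj (\<gamma> x) = proj x"
  shows "transition (sheet_chart U) (sheet_chart V) x = \<gamma> x"
  using assms transition_sheet[OF assms(1,3), of V] inv_into_f_f[of proj V "\<gamma> x"]
  by (simp add: sheet_def)

text \<open>Between two sheets the transition map is locally any given deck transformation that maps one point
  to the other. The identity yields that the pieces of the pullback fit together, a generator yields
  their invariance.\<close>

lemma one_form_change_of_sheet:
  assumes \<eta>: "smooth_one_form (quotient_atlas X (transformation_group X F)) \<eta>"
    and UV: "sheet U" "sheet V" and x: "x \<in> U" "\<gamma> x \<in> V"
    and \<gamma>: "\<And>y. y \<in> X \<Longrightarrow> proj (\<gamma> y) = proj y" "(\<gamma> has_derivative \<gamma>') (at x)"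
  shows "\<eta> (sheet_chart U) x v = \<eta> (sheet_chart V) (\<gamma> x) (\<gamma>' v)"
proof -
  have X: "U \<subseteq> X" and oUV: "open U" "open V" using UV by (auto simp: sheet_def)
  let ?\<tau> = "transition (sheet_chart U) (sheet_chart V)"
  have tau: "?\<tau> y = \<gamma> y" if "y \<in> U" "\<gamma> y \<in> V" for y
    using transition_sheet_generator[where \<gamma> = \<gamma>, OF UV that] \<gamma>(1) that X by blast
  have "continuous (at x) \<gamma>" using \<gamma>(2) by (rule has_derivative_continuous)
  then obtain W where W: "open W" "x \<in> W" "\<And>y. y \<in> W \<Longrightarrow> \<gamma> y \<in> V"
    using oUV x(2) by (metis continuous_at_open)
  have "(?\<tau> has_derivative \<gamma>') (at x)"
    using \<gamma>(2) by (rule has_derivative_transform_within_open[of _ _ _ _ "U \<inter> W"])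
       (use W oUV x tau in auto)
  then have d: "frechet_derivative ?\<tau> (at x) = \<gamma>'" by (rule frechet_derivative_at[symmetric])
  have "proj x \<in> proj ` U \<inter> proj ` V" using x \<gamma>(1)[of x] X by (metis IntI imageI subsetD)
  then have "x \<in> overlap (sheet_chart U) (sheet_chart V)"
    unfolding overlap_def sheet_chart_def using x UV(1)
    by (auto simp: sheet_def intro!: image_eqI[of _ _ "proj x"])
  then have "\<eta> (sheet_chart U) x v = \<eta> (sheet_chart V) (?\<tau> x) (frechet_derivative ?\<tau> (at x) v)"
    using \<eta> UV unfolding smooth_one_form_def quotient_atlas_eq by blast
  then show ?thesis using tau x d by simp
qed

text \<open>The value at \<open>x\<close> does not depend on the sheet that is chosen, by \<open>one_form_change_of_sheet\<close>
  applied to the identity.\<close>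

definition pullback :: "(c2 set chart \<Rightarrow> c2 \<Rightarrow> c2 \<Rightarrow> real) \<Rightarrow> c2 \<Rightarrow> c2 \<Rightarrow> real" where
  "pullback \<eta> x = \<eta> (sheet_chart (SOME U. sheet U \<and> x \<in> U)) x"

context
  fixes \<eta> assumes \<eta>: "smooth_one_form (quotient_atlas X (transformation_group X F)) \<eta>"
begin

lemma pullback_sheet:
  assumes U: "sheet U" "x \<in> U"
  shows "\<eta> (sheet_chart U) x = pullback \<eta> x"
proof -
  have V: "sheet (SOME U. sheet U \<and> x \<in> U) \<and> x \<in> (SOME U. sheet U \<and> x \<in> U)"
    using U by (intro someI[of "\<lambda>U. sheet U \<and> x \<in> U"]) simp
  show ?thesis unfolding pullback_def
    using one_form_change_of_sheet[where \<gamma> = "\<lambda>x. x" and \<gamma>' = "\<lambda>v. v", OF \<eta> U(1) conjunct1[OF V] U(2)] V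
    by auto
qed

lemma pullback_linear: "x \<in> X \<Longrightarrow> linear (pullback \<eta> x)"
  using sheet_exists[of x] \<eta> pullback_sheet[of _ x]
  unfolding smooth_one_form_def quotient_atlas_eq by (metis chart_image_sheet imageI mem_Collect_eq)

lemma smooth_on_sheet: "sheet U \<Longrightarrow> smooth_on U (\<lambda>x. \<eta> (sheet_chart U) x v)"
  using \<eta> unfolding smooth_one_form_def quotient_atlas_eq by (metis chart_image_sheet imageI mem_Collect_eq)

lemma pullback_smooth: "smooth_on X (\<lambda>x. pullback \<eta> x v)"
  unfolding smooth_on_def
proof (rule allI, rule Ck_on_local)
  fix k x assume "x \<in> X"
  then obtain U where U: "sheet U" "x \<in> U" using sheet_exists by blast
  have "Ck_on k U (\<lambda>x. pullback \<eta> x v)"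
  proof (rule Ck_on_cong)
    show "open U" using U(1) by (simp add: sheet_def)
    show "\<eta> (sheet_chart U) x v = pullback \<eta> x v" if "x \<in> U" for x
      using pullback_sheet[OF U(1) that] by simp
    show "Ck_on k U (\<lambda>x. \<eta> (sheet_chart U) x v)"
      using smooth_on_sheet[OF U(1)] unfolding smooth_on_def by blast
  qed
  then show "\<exists>U. open U \<and> x \<in> U \<and> U \<subseteq> X \<and> Ck_on k U (\<lambda>x. pullback \<eta> x v)"
    using U unfolding sheet_def by blast
qed

lemma pullback_ext_d1:
  assumes U: "sheet U" "x \<in> U"
  shows "ext_d1 (\<eta> (sheet_chart U)) x u v = ext_d1 (pullback \<eta>) x u v"
proof -
  have "(\<lambda>x. \<eta> (sheet_chart U) x v) differentiable (at x)" for v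
    using smooth_on_sheet[OF U(1)] U(2) unfolding smooth_on_def by (metis Ck_on.simps(2))
  then have "frechet_derivative (\<lambda>x. \<eta> (sheet_chart U) x v) (at x)
      = frechet_derivative (\<lambda>x. pullback \<eta> x v) (at x)" for v
    using U by (intro frechet_derivative_transform_within_open[of _ _ U])
      (auto simp: sheet_def pullback_sheet)
  then show ?thesis by (simp add: ext_d1_def)
qed

lemma pullback_invariant:
  assumes f: "f \<in> F" and x: "x \<in> X" and f': "(f has_derivative f') (at x)"
  shows "pullback \<eta> (f x) (f' v) = pullback \<eta> x v"
proof -
  obtain U where U: "sheet U" "x \<in> U" using sheet_exists x by blast
  have UX: "U \<subseteq> X" using U by (simp add: sheet_def)
  have fX: "f ` X = X" "inj_on f X" using bij[OF f] by (auto simp: bij_betw_def)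
  have "inj_on proj (f ` U)"
  proof (rule inj_onI, elim imageE)
    fix y y' u u' assume "u \<in> U" "u' \<in> U" "y = f u" "y' = f u'" "proj y = proj y'"
    then show "y = y'" using proj_generator[OF f] U UX
      by (metis inj_onD sheet_def subsetD)
  qed
  then have V: "sheet (f ` U)" using U fX open_map[OF f] by (auto simp: sheet_def)
  show ?thesis
    using one_form_change_of_sheet[where \<gamma> = f, OF \<eta> U(1) V U(2) _ _ f'] proj_generator[OF f] U
      pullback_sheet[OF U] pullback_sheet[OF V] by simp
qed

end

end

section \<open>The Heisenberg lattice and the Inoue group\<close>

lemma open_CH: "open CH"
  unfolding CH_def by (intro open_Times open_UNIV open_halfspace_Im_gt)

lemma convex_CH: "convex CH"
  unfolding CH_def by (intro convex_Times convex_UNIV convex_halfspace_Im_gt)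

text \<open>The Heisenberg group, acting by affine holomorphic maps; \<open>heis 0 0 C\<close> are the central elements.\<close>

definition heis :: "real \<Rightarrow> real \<Rightarrow> real \<Rightarrow> c2 \<Rightarrow> c2" where
  "heis A B C = (\<lambda>(z, \<zeta>). (z + of_real B * \<zeta> + of_real C, \<zeta> + of_real A))"

lemma heis_has_derivative: "(heis A B C has_derivative (\<lambda>v. (fst v + of_real B * snd v, snd v))) (at x)"
  unfolding heis_def split_beta by (auto intro!: derivative_eq_intros)

lemma heis_comp: "heis A B C (heis A' B' C' x) = heis (A + A') (B + B') (C + C' + B * A') x"
  by (auto simp: heis_def split_beta algebra_simps)

text \<open>Both families at once: \<open>\<epsilon> = det N\<close> is \<open>1\<close> for \<open>S\<^sup>+\<close> and \<open>-1\<close> for \<open>S\<^sup>-\<close>, the eigenvalues of \<open>N\<close> are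
  \<open>\<alpha>\<close> and \<open>\<epsilon> / \<alpha>\<close>, and \<open>g\<^sub>0\<close> is \<open>(z, \<zeta>) \<mapsto> (\<epsilon> z, \<alpha> \<zeta>)\<close>.\<close>

locale inoue_data =
  fixes \<epsilon> n11 n12 n21 n22 p q r :: int and \<alpha> a1 a2 b1 b2 c1 c2 :: real
  assumes det: "n11 * n22 - n12 * n21 = \<epsilon>" and eps: "\<epsilon> = 1 \<or> \<epsilon> = - 1"
    and \<alpha>: "\<alpha> > 1" and r: "r \<noteq> 0"
    and a: "a1 \<noteq> 0 \<or> a2 \<noteq> 0" "of_int n11 * a1 + of_int n12 * a2 = \<alpha> * a1" "of_int n21 * a1 + of_int n22 * a2 = \<alpha> * a2"
    and b: "b1 \<noteq> 0 \<or> b2 \<noteq> 0" "of_int n11 * b1 + of_int n12 * b2 = \<epsilon> / \<alpha> * b1"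
         "of_int n21 * b1 + of_int n22 * b2 = \<epsilon> / \<alpha> * b2"
    and c1: "\<epsilon> * c1 = n11 * c1 + n12 * c2
       + (1/2 * n11 * (n11 - 1) * a1 * b1 + 1/2 * n12 * (n12 - 1) * a2 * b2 + n11 * n12 * b1 * a2)
       + (b1 * a2 - b2 * a1) / r * p"
    and c2: "\<epsilon> * c2 = n21 * c1 + n22 * c2
       + (1/2 * n21 * (n21 - 1) * a1 * b1 + 1/2 * n22 * (n22 - 1) * a2 * b2 + n21 * n22 * b1 * a2)
       + (b1 * a2 - b2 * a1) / r * q"
begin

definition \<Delta> :: real where "\<Delta> = b1 * a2 - b2 * a1"

text \<open>The power \<open>g\<^sub>0\<^sup>k\<close>.\<close>

definition dil :: "int \<Rightarrow> c2 \<Rightarrow> c2" where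
  "dil k = (\<lambda>(z, \<zeta>). (of_real (of_int \<epsilon> powi k) * z, of_real (\<alpha> powi k) * \<zeta>))"

text \<open>The lattice element \<open>g\<^sub>1\<^sup>m g\<^sub>2\<^sup>n g\<^sub>3\<^sup>l\<close>. The quadratic terms in \<open>m\<close> and \<open>n\<close> accumulate because each
  factor shears \<open>z\<close> by a multiple of the \<open>\<zeta>\<close> already translated; with \<open>m, n\<close> a row of \<open>N\<close> they are the
  numbers \<open>e\<^sub>1, e\<^sub>2\<close> of the construction.\<close>

definition lat :: "int \<Rightarrow> int \<Rightarrow> int \<Rightarrow> c2 \<Rightarrow> c2" where
  "lat m n l = heis (m * a1 + n * a2) (m * b1 + n * b2)
     (m * c1 + n * c2 + 1/2 * m * (m - 1) * a1 * b1 + 1/2 * n * (n - 1) * a2 * b2 + m * n * b1 * a2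
      + l * (\<Delta> / r))"

text \<open>Eigenvectors for the distinct eigenvalues \<open>\<alpha>\<close> and \<open>\<epsilon> / \<alpha>\<close> are not parallel.\<close>

lemma \<Delta>_nz: "\<Delta> \<noteq> 0"
proof
  assume "\<Delta> = 0"
  then have par: "b1 * a2 = b2 * a1" by (simp add: \<Delta>_def)
  obtain \<mu> where mu: "b1 = \<mu> * a1" "b2 = \<mu> * a2"
  proof (cases "a1 = 0")
    case True
    then show ?thesis using a(1) par that[of "b2 / a2"] by auto
  next
    case False
    then show ?thesis using par that[of "b1 / a1"] by (auto simp: field_simps)
  qed
  have "\<mu> * (\<alpha> * a1) = \<epsilon> / \<alpha> * b1" "\<mu> * (\<alpha> * a2) = \<epsilon> / \<alpha> * b2"
    unfolding a(2,3)[symmetric] b(2,3)[symmetric] unfolding mu by (simp_all add: algebra_simps)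
  then have "\<epsilon> / \<alpha> * b1 = \<alpha> * b1" "\<epsilon> / \<alpha> * b2 = \<alpha> * b2"
    by (metis mu mult.left_commute)+
  then have "\<epsilon> / \<alpha> = \<alpha>" using b(1) by (metis mult_right_cancel)
  then have "\<alpha> * \<alpha> = of_int \<epsilon>" using \<alpha> by (simp add: field_simps)
  moreover have "\<alpha> * \<alpha> > 1" using \<alpha> by (simp add: less_1_mult)
  ultimately show False using eps by auto
qed

text \<open>The group law of the lattice. Moving \<open>g\<^sub>2\<^sup>n\<close> past \<open>g\<^sub>1\<close> to the power \<open>m'\<close> costs a power of the
  commutator \<open>[g\<^sub>1, g\<^sub>2] = g\<^sub>3\<^sup>r\<close>, a translation by \<open>\<Delta>\<close>.\<close>

lemma lat_comp: "lat m n l (lat m' n' l' x) = lat (m + m') (n + n') (l + l' - r * n * m') x"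
proof -
  define \<delta> where "\<delta> = \<Delta> / r"
  have "r * \<delta> = b1 * a2 - b2 * a1" using r by (simp add: \<Delta>_def \<delta>_def)
  then have e: "n * m' * (b2 * a1 - b1 * a2 + r * \<delta>) = 0" by simp
  let ?C = "\<lambda>m n l. m * c1 + n * c2 + 1/2 * m * (m - 1) * a1 * b1 + 1/2 * n * (n - 1) * a2 * b2
      + m * n * b1 * a2 + l * \<delta>"
  have "?C m n l + ?C m' n' l' + (m * b1 + n * b2) * (m' * a1 + n' * a2)
      = ?C (m + m') (n + n') (l + l' - r * n * m') + n * m' * (b2 * a1 - b1 * a2 + r * \<delta>)"
    by (simp add: field_simps)
  moreover have "m * a1 + n * a2 + (m' * a1 + n' * a2) = (m + m') * a1 + (n + n') * a2"
    "m * b1 + n * b2 + (m' * b1 + n' * b2) = (m + m') * b1 + (n + n') * b2"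
    by (simp_all add: algebra_simps)
  ultimately show ?thesis unfolding lat_def \<delta>_def[symmetric] heis_comp e by simp
qed

lemma lat_0: "lat 0 0 0 = id"
  by (auto simp: lat_def heis_def)

lemma lat_inverse: "lat m n l (lat (- m) (- n) (- l - r * n * m) x) = x"
  "lat (- m) (- n) (- l - r * n * m) (lat m n l x) = x"
  by (simp_all add: lat_comp lat_0)

lemma dil_0: "dil 0 = id"
  by (auto simp: dil_def)

lemma dil_add: "dil j (dil k x) = dil (j + k) x"
  using eps \<alpha> by (auto simp: dil_def split_beta power_int_add)

lemma dil_inverse: "dil k (dil (- k) x) = x" "dil (- k) (dil k x) = x"
  by (simp_all add: dil_add dil_0)


lemma dil_heis:
  fixes A B C :: real
  shows "dil 1 (heis A B C x) = heis (\<alpha> * A) (\<epsilon> / \<alpha> * B) (\<epsilon> * C) (dil 1 x)"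
  using \<alpha> by (simp add: dil_def heis_def split_beta algebra_simps)

lemma dil_lat_central: "dil 1 (lat 0 0 l x) = lat 0 0 (\<epsilon> * l) (dil 1 x)"
  by (simp add: lat_def dil_heis mult.assoc)

text \<open>Conjugation by \<open>g\<^sub>0\<close> maps the lattice into itself and multiplies the row vector \<open>(m, n)\<close> of exponents
  by \<open>N\<close> from the right. For the generators \<open>g\<^sub>1, g\<^sub>2\<close> this is the eigenvector equations together with
  the equation for \<open>c\<close>, where the integers \<open>p, q\<close> are the resulting exponents of \<open>g\<^sub>3\<close>; the general
  case follows because the property passes to products and inverses.\<close>

lemma dil_lat:
  "\<exists>l'. \<forall>x. dil 1 (lat m n l x) = lat (m * n11 + n * n21) (m * n12 + n * n22) l' (dil 1 x)"
proof -
  define P where "P m n l \<longleftrightarrow>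
    (\<exists>l'. \<forall>x. dil 1 (lat m n l x) = lat (m * n11 + n * n21) (m * n12 + n * n22) l' (dil 1 x))" for m n l
  have comp: "P (m + m') (n + n') (l + l' - r * n * m')" if PP: "P m n l" "P m' n' l'" for m n l m' n' l'
  proof -
    obtain L L' where "\<And>x. dil 1 (lat m n l x) = lat (m * n11 + n * n21) (m * n12 + n * n22) L (dil 1 x)"
      "\<And>x. dil 1 (lat m' n' l' x) = lat (m' * n11 + n' * n21) (m' * n12 + n' * n22) L' (dil 1 x)"
      using PP unfolding P_def by blast
    then have "dil 1 (lat (m + m') (n + n') (l + l' - r * n * m') x) =
       lat (m * n11 + n * n21 + (m' * n11 + n' * n21)) (m * n12 + n * n22 + (m' * n12 + n' * n22))
         (L + L' - r * (m * n12 + n * n22) * (m' * n11 + n' * n21)) (dil 1 x)" for x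
      by (simp flip: lat_comp)
    then show ?thesis unfolding P_def
      by (intro exI allI) (auto simp: distrib_right add_ac)
  qed
  have inv: "P (- m) (- n) (- l - r * n * m)" if PP: "P m n l" for m n l
  proof -
    obtain L where L: "\<And>x. dil 1 (lat m n l x) = lat (m * n11 + n * n21) (m * n12 + n * n22) L (dil 1 x)"
      using PP unfolding P_def by blast
    let ?M = "m * n11 + n * n21" let ?N = "m * n12 + n * n22"
    have "dil 1 (lat (- m) (- n) (- l - r * n * m) x) = lat (- ?M) (- ?N) (- L - r * ?N * ?M) (dil 1 x)" for x
    proof -
      have "dil 1 x = lat ?M ?N L (dil 1 (lat (- m) (- n) (- l - r * n * m) x))"
        using L[of "lat (- m) (- n) (- l - r * n * m) x"] by (simp only: lat_inverse)
      then show ?thesis by (metis lat_inverse(2))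
    qed
    then show ?thesis unfolding P_def by (intro exI allI) (auto simp: minus_add_distrib)
  qed
  have "P 1 0 0" unfolding P_def
  proof (intro exI allI)
    fix x :: c2
    show "dil 1 (lat 1 0 0 x) = lat (1 * n11 + 0 * n21) (1 * n12 + 0 * n22) p (dil 1 x)"
      unfolding lat_def dil_heis using a(2) b(2) c1 by (simp add: \<Delta>_def ac_simps)
  qed
  moreover have "P 0 1 0" unfolding P_def
  proof (intro exI allI)
    fix x :: c2
    show "dil 1 (lat 0 1 0 x) = lat (0 * n11 + 1 * n21) (0 * n12 + 1 * n22) q (dil 1 x)"
      unfolding lat_def dil_heis using a(3) b(3) c2 by (simp add: \<Delta>_def ac_simps)
  qed
  moreover have P3: "P 0 0 l" for l unfolding P_def
    by (rule exI[of _ "\<epsilon> * l"]) (simp add: dil_lat_central)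
  ultimately have P1: "P m 0 0" and P2: "P 0 n 0" for m n
  proof -
    show "P m 0 0"
    proof (induction m rule: int_induct[where k = 0])
      case (step1 i) then show ?case using comp[of i 0 0 1 0 0] \<open>P 1 0 0\<close> by simp
    next
      case (step2 i) then show ?case using comp[of i 0 0 "-1" 0 0] inv[OF \<open>P 1 0 0\<close>] by simp
    qed (rule P3)
    show "P 0 n 0"
    proof (induction n rule: int_induct[where k = 0])
      case (step1 i) then show ?case using comp[of 0 i 0 0 1 0] \<open>P 0 1 0\<close> by simp
    next
      case (step2 i) then show ?case using comp[of 0 i 0 0 "-1" 0] inv[OF \<open>P 0 1 0\<close>] by simp
    qed (rule P3)
  qed
  have "P m n l" using comp[OF comp[OF P1[of m] P2[of n]] P3[of l]] by simp
  then show ?thesis by (simp add: P_def)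
qed

text \<open>Conjugation by \<open>g\<^sub>0\<close> is onto the lattice. Since \<open>N\<close> is invertible over the integers, a preimage can
  be found up to a power of \<open>g\<^sub>3\<close>, and \<open>g\<^sub>3\<close> is conjugated to \<open>g\<^sub>3\<close> or its inverse.\<close>

lemma lat_dil_1: "\<exists>m' n' l'. \<forall>x. lat m n l (dil 1 x) = dil 1 (lat m' n' l' x)"
proof -
  \<comment> \<open>The row vector \<open>(m, n) N\<^sup>-\<^sup>1\<close>, as \<open>\<epsilon>\<close> is its own inverse.\<close>
  define m' where "m' = \<epsilon> * (m * n22 - n * n21)"
  define n' where "n' = \<epsilon> * (n * n11 - m * n12)"
  have ee: "\<epsilon> * \<epsilon> = 1" using eps by auto
  have "m' * n11 + n' * n21 = \<epsilon> * m * (n11 * n22 - n12 * n21)"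
    "m' * n12 + n' * n22 = \<epsilon> * n * (n11 * n22 - n12 * n21)"
    by (simp_all add: m'_def n'_def algebra_simps)
  then have mn: "m' * n11 + n' * n21 = m" "m' * n12 + n' * n22 = n"
    using ee by (simp_all add: det mult.commute mult.left_commute)
  obtain L where L: "\<And>x. dil 1 (lat m' n' 0 x) = lat m n L (dil 1 x)"
    using dil_lat[of m' n' 0] unfolding mn by blast
  have "lat m n l (dil 1 x) = dil 1 (lat 0 0 (\<epsilon> * (l - L)) (lat m' n' 0 x))" for x
  proof -
    have "lat m n l (dil 1 x) = lat 0 0 (l - L) (lat m n L (dil 1 x))"
      by (simp add: lat_comp)
    also have "\<dots> = lat 0 0 (l - L) (dil 1 (lat m' n' 0 x))" by (simp add: L)
    also have "\<dots> = dil 1 (lat 0 0 (\<epsilon> * (l - L)) (lat m' n' 0 x))"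
      using ee by (simp add: dil_lat_central flip: mult.assoc)
    finally show ?thesis .
  qed
  then show ?thesis unfolding lat_comp by blast
qed

lemma lat_dil: "\<exists>m' n' l'. \<forall>x. lat m n l (dil k x) = dil k (lat m' n' l' x)"
proof (induction k arbitrary: m n l rule: int_induct[where k = 0])
  case base then show ?case by (auto simp: dil_0)
next
  case (step1 i)
  obtain m' n' l' where 1: "\<And>x. lat m n l (dil i x) = dil i (lat m' n' l' x)" using step1(2) by blast
  obtain m'' n'' l'' where 2: "\<And>x. lat m' n' l' (dil 1 x) = dil 1 (lat m'' n'' l'' x)"
    using lat_dil_1 by blast
  have "lat m n l (dil (i + 1) x) = dil (i + 1) (lat m'' n'' l'' x)" for x
    using 1 2 by (simp flip: dil_add)
  then show ?case by blast
next
  case (step2 i)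
  obtain m' n' l' where 1: "\<And>x. lat m n l (dil i x) = dil i (lat m' n' l' x)" using step2(2) by blast
  obtain m'' n'' l'' where 2: "\<And>x. dil 1 (lat m' n' l' x) = lat m'' n'' l'' (dil 1 x)"
    using dil_lat by blast
  have "lat m' n' l' (dil (- 1) x) = dil (- 1) (lat m'' n'' l'' x)" for x
    using 2[of "dil (- 1) x"] by (metis dil_inverse)
  moreover have "dil (i - 1) x = dil i (dil (- 1) x)" for x by (simp add: dil_add)
  ultimately have "lat m n l (dil (i - 1) x) = dil (i - 1) (lat m'' n'' l'' x)" for x
    using 1 by simp
  then show ?case by blast
qed

lemma dil_lat_CH: "dil k (lat m n l x) \<in> CH \<longleftrightarrow> x \<in> CH"
proof -
  have "\<alpha> powi k > 0" using \<alpha> by (simp add: zero_less_power_int)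
  then show ?thesis
    by (cases x) (auto simp: dil_def lat_def heis_def CH_def zero_less_mult_iff
      simp del: of_real_power_int)
qed

text \<open>The window \<open>(t0 / \<surd>\<alpha>, t0 \<surd>\<alpha>)\<close> has ratio \<open>\<alpha>\<close>, so no positive power of \<open>\<alpha>\<close> maps a point of it into it.\<close>

lemma dilation_exponent_le_0:
  assumes t0: "0 < t0" and t: "t0 / sqrt \<alpha> < t" "\<alpha> powi k * t < t0 * sqrt \<alpha>"
  shows "k \<le> 0"
proof (rule ccontr)
  assume "\<not> k \<le> 0"
  then have k: "\<alpha> powi 1 \<le> \<alpha> powi k" using \<alpha> by (intro power_int_increasing) auto
  have "0 < t0 / sqrt \<alpha>" using t0 \<alpha> by simp
  then have "0 \<le> t" using t(1) by linarith
  have "t0 * sqrt \<alpha> = t0 * (\<alpha> / sqrt \<alpha>)" using \<alpha> by (simp add: real_div_sqrt)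
  also have "\<dots> = \<alpha> * (t0 / sqrt \<alpha>)" by simp
  also have "\<dots> < \<alpha> * t" using t(1) \<alpha> by (intro mult_strict_left_mono) auto
  also have "\<dots> \<le> \<alpha> powi k * t" using k \<open>0 \<le> t\<close> by (intro mult_right_mono) auto
  finally show False using t(2) by simp
qed

text \<open>The coordinate \<open>t\<close> detects the power of \<open>g\<^sub>0\<close>. Once this is trivial, \<open>g\<^sub>1\<^sup>m g\<^sub>2\<^sup>n g\<^sub>3\<^sup>l\<close> displaces
  \<open>w\<close> by \<open>m a1 + n a2\<close> and \<open>y\<close> by \<open>t (m b1 + n b2)\<close>. If both are small, Cramer's rule makes \<open>m \<Delta>\<close> and
  \<open>n \<Delta>\<close> smaller than \<open>\<Delta>\<close> in absolute value, so \<open>m = n = 0\<close>. What remains is the central translation by \<open>l \<Delta> / r\<close>, and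
  a small displacement of \<open>x\<close> forces \<open>l = 0\<close>.\<close>

lemma wandering_neighbourhood:
  assumes "x \<in> CH"
  shows "\<exists>U. open U \<and> x \<in> U \<and> U \<subseteq> CH \<and>
    (\<forall>u\<in>U. \<forall>k m n l. dil k (lat m n l u) \<in> U \<longrightarrow> dil k (lat m n l u) = u)"
proof -
  obtain z0 \<zeta>0 where x: "x = (z0, \<zeta>0)" by force
  define t0 where "t0 = Im \<zeta>0"
  define s where "s = sqrt \<alpha>"
  have t0: "t0 > 0" using assms by (simp add: x t0_def CH_def)
  have s: "s > 1" using \<alpha> by (simp add: s_def)
  \<comment> \<open>The radius \<open>\<delta>\<close> below is chosen so that \<open>2 \<delta> M = \<bar>\<Delta>\<bar>\<close>; the summands of \<open>M\<close> serve the bounds for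
    \<open>m \<Delta>\<close> and \<open>n \<Delta>\<close> by Cramer's rule, where \<open>s / t0\<close> bounds \<open>1 / t\<close>, and for \<open>l \<Delta>\<close>.\<close>
  define M where "M = (\<bar>a1\<bar> + \<bar>a2\<bar>) * s / t0 + \<bar>b1\<bar> + \<bar>b2\<bar> + \<bar>r\<bar> + 1"
  have M: "M > 0" using t0 s by (auto simp: M_def intro!: add_nonneg_pos)
  define \<delta> where "\<delta> = \<bar>\<Delta>\<bar> / (2 * M)"
  have \<delta>: "\<delta> > 0" "2 * \<delta> * M = \<bar>\<Delta>\<bar>" using M \<Delta>_nz by (auto simp: \<delta>_def)
  define U where "U = {u. \<bar>Re (fst u) - Re z0\<bar> < \<delta> \<and> \<bar>Im (fst u) - Im z0\<bar> < \<delta>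
     \<and> \<bar>Re (snd u) - Re \<zeta>0\<bar> < \<delta> \<and> t0 / s < Im (snd u) \<and> Im (snd u) < t0 * s}"
  have "open U" unfolding U_def
    by (intro open_Collect_conj open_Collect_less continuous_intros)
  have "x \<in> U" using \<delta> t0 s by (simp add: U_def x t0_def field_simps)
  have UCH: "U \<subseteq> CH"
    using t0 s by (auto simp: U_def CH_def intro: less_trans[of 0 "t0 / s"])
  have small_multiple: "j = 0" if "\<bar>of_int j * \<Delta>\<bar> < \<bar>\<Delta>\<bar>" for j :: int
  proof -
    have "\<bar>of_int j\<bar> * \<bar>\<Delta>\<bar> < 1 * \<bar>\<Delta>\<bar>" using that by (simp add: abs_mult)
    then have "\<bar>real_of_int j\<bar> < 1" by (rule mult_right_less_imp_less) simp
    then show ?thesis by linarith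
  qed
  have "dil k (lat m n l u) = u"
    if u: "u \<in> U" and u': "dil k (lat m n l u) \<in> U" for u k m n l
  proof -
    define A B C where "A = m * a1 + n * a2" and "B = m * b1 + n * b2" and
      "C = m * c1 + n * c2 + 1/2 * m * (m - 1) * a1 * b1 + 1/2 * n * (n - 1) * a2 * b2 + m * n * b1 * a2
      + l * (\<Delta> / r)"
    have dl: "dil k (lat m n l u) = (of_real (of_int \<epsilon> powi k) * (fst u + of_real B * snd u + of_real C),
        of_real (\<alpha> powi k) * (snd u + of_real A))"
      by (simp add: dil_def lat_def heis_def split_beta A_def B_def C_def del: of_real_power_int)
    define t where "t = Im (snd u)"
    have tb: "t0 / s < t" "t < t0 * s" "t0 / s < \<alpha> powi k * t" "\<alpha> powi k * t < t0 * s"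
      using u u' by (auto simp: U_def dl t_def simp del: of_real_power_int)
    have "k \<le> 0" using dilation_exponent_le_0[OF t0] tb by (simp add: s_def)
    moreover have "\<alpha> powi (- k) * (\<alpha> powi k * t) = t"
      using \<alpha> by (simp add: power_int_minus)
    then have "- k \<le> 0"
      using tb unfolding s_def
      by (metis dilation_exponent_le_0[OF t0])
    ultimately have k: "k = 0" by simp
    have u0: "(fst u + of_real B * snd u + of_real C, snd u + of_real A) \<in> U"
      using u' unfolding dl unfolding k by simp
    have A: "\<bar>A\<bar> < 2 * \<delta>" and Bt: "\<bar>B * t\<bar> < 2 * \<delta>"
    proof -
      have "\<bar>Re (snd u) - Re \<zeta>0\<bar> < \<delta>" "\<bar>Re (snd u) + A - Re \<zeta>0\<bar> < \<delta>"
        using u u0 by (simp_all add: U_def)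
      then show "\<bar>A\<bar> < 2 * \<delta>" by linarith
      have "\<bar>Im (fst u) - Im z0\<bar> < \<delta>" "\<bar>Im (fst u) + B * t - Im z0\<bar> < \<delta>"
        using u u0 by (simp_all add: U_def t_def)
      then show "\<bar>B * t\<bar> < 2 * \<delta>" by linarith
    qed
    have "0 < t" using UCH u by (auto simp: CH_def t_def)
    have B: "\<bar>B\<bar> \<le> 2 * \<delta> * (s / t0)"
    proof -
      have "\<bar>B\<bar> * (t0 / s) \<le> \<bar>B\<bar> * t" using tb by (intro mult_left_mono) auto
      also have "\<dots> \<le> 2 * \<delta>" using Bt \<open>0 < t\<close> by (simp add: abs_mult)
      finally show ?thesis using t0 s by (simp add: field_simps)
    qed
    have small: "\<bar>d * B - e * A\<bar> < \<bar>\<Delta>\<bar>" if "\<bar>d\<bar> \<le> \<bar>a1\<bar> + \<bar>a2\<bar>" "\<bar>e\<bar> \<le> \<bar>b1\<bar> + \<bar>b2\<bar>" for d e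
    proof -
      have "\<bar>d * B - e * A\<bar> \<le> \<bar>d\<bar> * \<bar>B\<bar> + \<bar>e\<bar> * \<bar>A\<bar>"
        using abs_triangle_ineq4[of "d * B" "e * A"] by (simp add: abs_mult)
      also have "\<dots> \<le> (\<bar>a1\<bar> + \<bar>a2\<bar>) * (2 * \<delta> * (s / t0)) + (\<bar>b1\<bar> + \<bar>b2\<bar>) * (2 * \<delta>)"
        by (intro add_mono mult_mono that B less_imp_le[OF A]) simp_all
      also have "\<dots> = 2 * \<delta> * (M - \<bar>r\<bar> - 1)" by (simp add: M_def algebra_simps)
      also have "\<dots> < 2 * \<delta> * M" using \<delta> by (intro mult_strict_left_mono) auto
      finally show ?thesis using \<delta> by simp
    qed
    have "a2 * B - b2 * A = m * \<Delta>" "(- a1) * B - (- b1) * A = n * \<Delta>"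
      by (simp_all add: A_def B_def \<Delta>_def algebra_simps)
    then have "\<bar>of_int m * \<Delta>\<bar> < \<bar>\<Delta>\<bar>" "\<bar>of_int n * \<Delta>\<bar> < \<bar>\<Delta>\<bar>"
      using small[of a2 b2] small[of "- a1" "- b1"] by auto
    then have mn: "m = 0" "n = 0" by (blast intro: small_multiple)+
    have "l = 0"
    proof -
      have "B = 0" by (simp add: B_def mn)
      then have "\<bar>Re (fst u) - Re z0\<bar> < \<delta>" "\<bar>Re (fst u) + C - Re z0\<bar> < \<delta>"
        using u u0 by (simp_all add: U_def)
      then have "\<bar>C\<bar> < 2 * \<delta>" by linarith
      have "C = l * \<Delta> / r" by (simp add: C_def mn)
      then have "of_int l * \<Delta> = C * r" using r by simp
      then have "\<bar>of_int l * \<Delta>\<bar> = \<bar>C\<bar> * \<bar>of_int r\<bar>" by (simp add: abs_mult)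
      also have "\<dots> < 2 * \<delta> * \<bar>of_int r\<bar>"
        using \<open>\<bar>C\<bar> < 2 * \<delta>\<close> r by (intro mult_strict_right_mono) auto
      also have "\<dots> \<le> 2 * \<delta> * M"
      proof (rule mult_left_mono)
        have "0 \<le> (\<bar>a1\<bar> + \<bar>a2\<bar>) * s / t0" using t0 s by simp
        then show "\<bar>of_int r\<bar> \<le> M" unfolding M_def by linarith
      qed (use \<delta> in simp)
      finally show ?thesis unfolding \<delta>(2) by (rule small_multiple)
    qed
    then show ?thesis by (simp add: k mn dil_0 lat_0)
  qed
  then show ?thesis
    using \<open>open U\<close> \<open>x \<in> U\<close> UCH by (intro exI[of _ U] conjI ballI allI impI)
qed

text \<open>The form of a general element of the group generated by \<open>g\<^sub>0, g\<^sub>1, g\<^sub>2, g\<^sub>3\<close>: these maps contain the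
  generators and, because \<open>g\<^sub>0\<close> normalises the lattice, they are closed under composition and inverses.\<close>

definition motion :: "int \<Rightarrow> int \<Rightarrow> int \<Rightarrow> int \<Rightarrow> c2 \<Rightarrow> c2" where
  "motion k m n l x = dil k (lat m n l x)"

lemma motion_motion: "\<exists>k'' m'' n'' l''. \<forall>x. motion k m n l (motion k' m' n' l' x) = motion k'' m'' n'' l'' x"
proof -
  obtain M N L where "\<And>x. lat m n l (dil k' x) = dil k' (lat M N L x)" using lat_dil by blast
  then have "motion k m n l (motion k' m' n' l' x) = motion (k + k') (M + m') (N + n') (L + l' - r * N * m') x" for x
    by (simp add: motion_def dil_add lat_comp)
  then show ?thesis by blast
qed

lemma motion_inverse:
  "\<exists>k' m' n' l'. (\<forall>x. motion k m n l (motion k' m' n' l' x) = x) \<and> (\<forall>x. motion k' m' n' l' (motion k m n l x) = x)"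
proof -
  obtain M N L where conj: "\<And>x. lat (- m) (- n) (- l - r * n * m) (dil (- k) x) = dil (- k) (lat M N L x)"
    using lat_dil by blast
  have "motion k m n l (motion (- k) M N L x) = x" "motion (- k) M N L (motion k m n l x) = x" for x
    by (simp_all add: motion_def conj[symmetric] lat_inverse dil_inverse)
  then show ?thesis by blast
qed

lemma motion_CH: "motion k m n l x \<in> CH \<longleftrightarrow> x \<in> CH"
  by (simp add: motion_def dil_lat_CH)

lemma continuous_motion: "continuous_on UNIV (motion k m n l)"
  unfolding motion_def lat_def heis_def dil_def split_beta by (intro continuous_intros)

lemma motion_bij: "bij_betw (motion k m n l) CH CH"
proof -
  obtain k' m' n' l' where "\<forall>x. motion k m n l (motion k' m' n' l' x) = x"
    "\<forall>x. motion k' m' n' l' (motion k m n l x) = x"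
    using motion_inverse by blast
  then show ?thesis
    by (intro bij_betw_byWitness[of _ "motion k' m' n' l'"]) (auto simp: motion_CH)
qed

lemma motion_open: "open U \<Longrightarrow> open (motion k m n l ` U)"
proof -
  assume "open U"
  obtain k' m' n' l' where i: "\<And>x. motion k m n l (motion k' m' n' l' x) = x"
    "\<And>x. motion k' m' n' l' (motion k m n l x) = x"
    using motion_inverse by blast
  have "motion k m n l ` U = motion k' m' n' l' -` U"
    using i by (auto simp: image_iff) (metis i(1))
  then show ?thesis using continuous_motion \<open>open U\<close> by (metis open_vimage)
qed

definition gens :: "(c2 \<Rightarrow> c2) set" where
  "gens = {dil 1, lat 1 0 0, lat 0 1 0, lat 0 0 1}"

lemma gens_motion: "f \<in> gens \<Longrightarrow> \<exists>k m n l. f = motion k m n l"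
proof -
  have "dil 1 = motion 1 0 0 0" "lat m n l = motion 0 m n l" for m n l
    by (auto simp: motion_def lat_0 dil_0)
  then show "f \<in> gens \<Longrightarrow> ?thesis" unfolding gens_def by blast
qed

lemma group_element_motion:
  assumes "h \<in> carrier (transformation_group CH gens)"
  shows "\<exists>k m n l. \<forall>x\<in>CH. h x = motion k m n l x"
proof -
  have restr: "restrict (motion k m n l) CH \<in> Bij CH" for k m n l
    using motion_bij by (auto simp: Bij_def cong: bij_betw_cong)
  have "h \<in> Bij CH \<and> (\<exists>k m n l. \<forall>x\<in>CH. h x = motion k m n l x)"
    if "h \<in> generate (BijGroup CH) ((\<lambda>f. restrict f CH) ` gens)" for h
    using that
  proof (induction rule: generate.induct)
    case one
    have "\<forall>x\<in>CH. (\<one>\<^bsub>BijGroup CH\<^esub>) x = motion 0 0 0 0 x"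
      by (simp add: BijGroup_def motion_def lat_0 dil_0)
    moreover have "\<one>\<^bsub>BijGroup CH\<^esub> \<in> Bij CH" by (simp add: BijGroup_def id_Bij)
    ultimately show ?case by (intro conjI exI)
  next
    case (incl h)
    then obtain k m n l where h: "h = restrict (motion k m n l) CH" using gens_motion by blast
    show ?case unfolding h by (rule conjI[OF restr]) auto
  next
    case (inv h)
    then obtain k m n l where h: "h = restrict (motion k m n l) CH" using gens_motion by blast
    have hB: "h \<in> Bij CH" unfolding h by (rule restr)
    obtain k' m' n' l' where i: "\<And>x. motion k m n l (motion k' m' n' l' x) = x"
      using motion_inverse by blast
    have "inv_into CH h x = motion k' m' n' l' x" if "x \<in> CH" for x
    proof (rule inv_into_f_eq)
      show "inj_on h CH" using hB by (simp add: Bij_def bij_betw_def)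
      show "motion k' m' n' l' x \<in> CH" "h (motion k' m' n' l' x) = x"
        using that i by (simp_all add: h motion_CH)
    qed
    then have "\<forall>x\<in>CH. (inv\<^bsub>BijGroup CH\<^esub> h) x = motion k' m' n' l' x"
      using inv_BijGroup[OF hB] by simp
    moreover have "inv\<^bsub>BijGroup CH\<^esub> h \<in> Bij CH"
      unfolding inv_BijGroup[OF hB] by (rule restrict_inv_into_Bij[OF hB])
    ultimately show ?case by (intro conjI exI)
  next
    case (eng h1 h2)
    then obtain k m n l k' m' n' l' where h: "\<And>x. x \<in> CH \<Longrightarrow> h1 x = motion k m n l x"
       "\<And>x. x \<in> CH \<Longrightarrow> h2 x = motion k' m' n' l' x" by blast
    obtain k'' m'' n'' l'' where "\<And>x. motion k m n l (motion k' m' n' l' x) = motion k'' m'' n'' l'' x"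
      using motion_motion by blast
    then have "\<forall>x\<in>CH. (h1 \<otimes>\<^bsub>BijGroup CH\<^esub> h2) x = motion k'' m'' n'' l'' x"
      using eng h by (auto simp: BijGroup_def compose_def motion_CH)
    moreover have "h1 \<otimes>\<^bsub>BijGroup CH\<^esub> h2 \<in> Bij CH" using eng by (simp add: BijGroup_def compose_Bij)
    ultimately show ?case by (intro conjI exI)
  qed
  then show ?thesis using assms by (simp add: transformation_group_def)
qed

sublocale covering_quotient CH gens
proof
  fix f assume "f \<in> gens"
  then show "bij_betw f CH CH" using gens_motion motion_bij by metis
next
  fix f and U :: "c2 set" assume "f \<in> gens" "open U"
  then show "open (f ` U)" using gens_motion motion_open by metis
next
  fix x assume "x \<in> CH"
  obtain U where U: "open U" "x \<in> U" "U \<subseteq> CH"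
    and fixed: "\<forall>u\<in>U. \<forall>k m n l. motion k m n l u \<in> U \<longrightarrow> motion k m n l u = u"
    using wandering_neighbourhood[OF \<open>x \<in> CH\<close>] unfolding motion_def by (elim exE conjE)
  have "h u = u" if u: "u \<in> U" and h: "h \<in> carrier (transformation_group CH gens)" and hu: "h u \<in> U" for u h
  proof -
    obtain k m n l where "h u = motion k m n l u"
      using group_element_motion[OF h] u U(3) by (meson subsetD)
    then show ?thesis using fixed[rule_format, OF u, of k m n l] hu by metis
  qed
  then show "\<exists>U. open U \<and> x \<in> U \<and> U \<subseteq> CH \<and>
      (\<forall>u\<in>U. \<forall>h\<in>carrier (transformation_group CH gens). h u \<in> U \<longrightarrow> h u = u)"
    using U by (intro exI[of _ U] conjI ballI impI)
qed

end

section \<open>Vanishing of the average of an exact form\<close>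

text \<open>On the slice \<open>t = 1\<close>, integrate over a period of \<open>x\<close>. The integral \<open>Q(y, w)\<close> of \<open>K\<close> is doubly
  periodic: the first two Heisenberg maps translate \<open>(y, w)\<close> and shear \<open>x\<close>, and the integral of a
  periodic function over a period is unchanged by shifts. The integral of \<open>\<partial>\<^sub>x F\<close> is zero, so
  \<open>\<partial>\<^sub>y Q\<close> is minus the integral of \<open>\<partial>\<^sub>x F - \<partial>\<^sub>y K\<close> and therefore negative everywhere, which the
  maximum of \<open>Q\<close> contradicts.\<close>

lemma lattice_invariant_divergence_not_positive:
  fixes K F :: "c2 \<Rightarrow> real" and K' F' :: "c2 \<Rightarrow> c2 \<Rightarrow> real"
  assumes K: "\<And>x. x \<in> CH \<Longrightarrow> (K has_derivative K' x) (at x)"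
    and F: "\<And>x. x \<in> CH \<Longrightarrow> (F has_derivative F' x) (at x)"
    and contK': "continuous_on CH (\<lambda>x. K' x (\<i>, 0))"
    and contF': "continuous_on CH (\<lambda>x. F' x (1, 0))"
    and K1: "\<And>x. x \<in> CH \<Longrightarrow> K (heis a1 b1 c1 x) = K x"
    and K2: "\<And>x. x \<in> CH \<Longrightarrow> K (heis a2 b2 c2 x) = K x"
    and K3: "\<And>x. x \<in> CH \<Longrightarrow> K (heis 0 0 D x) = K x"
    and F3: "\<And>x. x \<in> CH \<Longrightarrow> F (heis 0 0 D x) = F x"
    and indep: "b1 * a2 - b2 * a1 \<noteq> 0" and "D \<noteq> 0"
    and pos: "\<And>x. x \<in> CH \<Longrightarrow> 0 < F' x (1, 0) - K' x (\<i>, 0)"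
  shows False
proof -
  define pt where "pt = (\<lambda>y w s. (Complex (D * s) y, Complex w 1))"
  have pt_alt: "pt = (\<lambda>y w s. (of_real (D * s) + \<i> * of_real y, of_real w + \<i>))"
    by (auto simp: pt_def fun_eq_iff complex_eq_iff)
  have ptCH: "pt y w s \<in> CH" for y w s by (simp add: pt_def CH_def)
  have cont_comp: "continuous_on UNIV (\<lambda>z. f (pt (fst (fst z)) (snd (fst z)) (snd z)))"
    if "continuous_on CH f" for f :: "c2 \<Rightarrow> real"
    by (rule continuous_on_compose2[OF that])
       (auto simp: pt_alt CH_def intro!: continuous_intros)
  have contK: "continuous_on CH K" and contF: "continuous_on CH F"
    by (intro continuous_at_imp_continuous_on ballI has_derivative_continuous[OF K]
        has_derivative_continuous[OF F]; assumption)+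
  define Q where "Q = (\<lambda>yw. integral (cbox 0 1) (\<lambda>s. K (pt (fst yw) (snd yw) s)))"
  have contQ: "continuous_on UNIV Q"
    unfolding Q_def
    by (rule integral_continuous_on_param)
       (use continuous_on_subset[OF cont_comp[OF contK]] in \<open>simp add: split_beta\<close>)
  have cont1: "continuous_on UNIV (\<lambda>s. f (pt y w s))" if "continuous_on CH f"
    for y w and f :: "c2 \<Rightarrow> real"
    using continuous_on_compose2[OF cont_comp[OF that], of UNIV "\<lambda>s. ((y, w), s)"]
    by (auto intro!: continuous_on_Pair_const)
  have Qper: "Q (y + B, w + A) = Q (y, w)"
    if inv: "\<And>x. x \<in> CH \<Longrightarrow> K (heis A B C x) = K x" for A B C y w
  proof -
    \<comment> \<open>The shear of \<open>x\<close>, measured in periods \<open>D\<close>.\<close>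
    define \<sigma> where "\<sigma> = - (B * w + C) / D"
    have "pt (y + B) (w + A) s = heis A B C (pt y w (s + \<sigma>))" for s
      using \<open>D \<noteq> 0\<close> by (simp add: pt_def heis_def complex_eq_iff \<sigma>_def field_simps)
    then have "K (pt (y + B) (w + A) s) = K (pt y w (s + \<sigma>))" for s
      using inv ptCH by metis
    moreover have "K (pt y w (s + 1)) = K (pt y w s)" for s
    proof -
      have "pt y w (s + 1) = heis 0 0 D (pt y w s)"
        by (simp add: pt_def heis_def complex_eq_iff algebra_simps)
      then show ?thesis using K3 ptCH by metis
    qed
    ultimately show ?thesis
      using integral_periodic_shift[OF cont1[OF contK], of y w \<sigma>] by (simp add: Q_def)
  qed
  have Qder: "((\<lambda>y. Q (y, w)) has_real_derivative
      integral (cbox 0 1) (\<lambda>s. K' (pt y w s) (\<i>, 0))) (at y)" for y w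
    unfolding Q_def fst_conv snd_conv
  proof (rule leibniz_rule_field_derivative)
    fix y s
    have 1: "((\<lambda>y. pt y w s) has_derivative (\<lambda>h. h *\<^sub>R (\<i>, 0))) (at y)"
      unfolding pt_alt by (auto intro!: derivative_eq_intros simp: fun_eq_iff scaleR_conv_of_real)
    have 2: "linear (K' (pt y w s))"
      using K[OF ptCH] has_derivative_linear by blast
    show "((\<lambda>y. K (pt y w s)) has_real_derivative K' (pt y w s) (\<i>, 0)) (at y)"
      using has_derivative_compose[OF 1 K[OF ptCH]] unfolding has_field_derivative_def
      by (rule has_derivative_eq_rhs) (simp add: linear_cmul[OF 2] fun_eq_iff del: scaleR_Pair)
  next
    fix y show "(\<lambda>s. K (pt y w s)) integrable_on cbox 0 1"
      using continuous_on_subset[OF cont1[OF contK]]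
      by (auto intro!: integrable_continuous_real)
  next
    have "continuous_on UNIV (\<lambda>z. K' (pt (fst z) w (snd z)) (\<i>, 0))"
      using continuous_on_compose2[OF cont_comp[OF contK'], of UNIV "\<lambda>z. ((fst z, w), snd z)"]
      by (simp add: continuous_on_Pair continuous_on_fst continuous_on_snd)
    then show "continuous_on (UNIV \<times> cbox 0 1) (\<lambda>(y, s). K' (pt y w s) (\<i>, 0))"
      unfolding split_beta using continuous_on_subset by blast
  qed auto
  have Qneg: "integral (cbox 0 1) (\<lambda>s. K' (pt y w s) (\<i>, 0)) < 0" for y w
  proof -
    have "((\<lambda>s. D * F' (pt y w s) (1, 0)) has_integral F (pt y w 1) - F (pt y w 0)) {0..1}"
    proof (rule fundamental_theorem_of_calculus)
      fix s :: real
      have 1: "((\<lambda>s. pt y w s) has_derivative (\<lambda>h. (h * D) *\<^sub>R (1, 0))) (at s within {0..1})"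
        unfolding pt_alt by (auto intro!: derivative_eq_intros simp: fun_eq_iff scaleR_conv_of_real)
      have 2: "linear (F' (pt y w s))"
        using F[OF ptCH] has_derivative_linear by blast
      show "((\<lambda>s. F (pt y w s)) has_vector_derivative D * F' (pt y w s) (1, 0)) (at s within {0..1})"
        using has_derivative_compose[OF 1 F[OF ptCH]] unfolding has_vector_derivative_def
        by (rule has_derivative_eq_rhs) (simp add: linear_cmul[OF 2] fun_eq_iff del: scaleR_Pair)
    qed simp
    moreover have "pt y w 1 = heis 0 0 D (pt y w 0)"
      by (simp add: pt_def heis_def complex_eq_iff)
    then have "F (pt y w 1) = F (pt y w 0)" using F3 ptCH by metis
    ultimately have "((\<lambda>s. D * F' (pt y w s) (1, 0)) has_integral 0) {0..1}" by simp
    from integral_unique[OF this] have "integral {0..1} (\<lambda>s. D * F' (pt y w s) (1, 0)) = 0" .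
    then have "integral {0..1} (\<lambda>s. F' (pt y w s) (1, 0)) = 0"
      using \<open>D \<noteq> 0\<close> by simp
    moreover have "integral {0..1} (\<lambda>s. K' (pt y w s) (\<i>, 0)) < integral {0..1} (\<lambda>s. F' (pt y w s) (1, 0))"
      by (rule integral_less_real)
         (use pos[OF ptCH] continuous_on_subset[OF cont1[OF contK']] continuous_on_subset[OF cont1[OF contF']] in auto)
    ultimately show ?thesis by simp
  qed
  show False
    by (rule doubly_periodic_partial_derivative_not_neg[OF contQ Qper[OF K1] Qper[OF K2] indep Qder Qneg])
qed

context inoue_data
begin

text \<open>The function \<open>f\<close> transforms under the group by an additive character. It kills \<open>g\<^sub>3\<close>, since
  \<open>g\<^sub>3\<^sup>r\<close> is a commutator. Invariance under conjugation by \<open>g\<^sub>0\<close> makes \<open>(\<chi>1, \<chi>2)\<close> a fixed vector of \<open>N\<close>,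
  and \<open>det (N - 1) = (\<alpha> - 1) (\<epsilon> / \<alpha> - 1) \<noteq> 0\<close>.\<close>

lemma lattice_character_trivial:
  fixes \<chi>1 \<chi>2 \<chi>3 \<chi>0 :: real and f :: "c2 \<Rightarrow> real"
  assumes f1: "\<And>x. x \<in> CH \<Longrightarrow> f (lat 1 0 0 x) = f x + \<chi>1"
    and f2: "\<And>x. x \<in> CH \<Longrightarrow> f (lat 0 1 0 x) = f x + \<chi>2"
    and f3: "\<And>x. x \<in> CH \<Longrightarrow> f (lat 0 0 1 x) = f x + \<chi>3"
    and f0: "\<And>x. x \<in> CH \<Longrightarrow> f (dil 1 x) = f x + \<chi>0"
  shows "\<chi>1 = 0 \<and> \<chi>2 = 0 \<and> \<chi>3 = 0"
proof -
  have latCH: "lat m n l x \<in> CH" if "x \<in> CH" for m n l x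
    using that dil_lat_CH[of 0] by (simp add: dil_0)
  have dilCH: "dil k x \<in> CH" if "x \<in> CH" for k x
    using that dil_lat_CH[of k 0 0 0] by (simp add: lat_0)
  have f1n: "f (lat m 0 0 x) = f x + m * \<chi>1" if "x \<in> CH" for m x
  proof (induction m rule: int_induct[where k = 0])
    case base then show ?case by (simp add: lat_0)
  next
    case (step1 i) then show ?case using f1[OF latCH[OF that], of i 0 0] by (simp add: lat_comp algebra_simps)
  next
    case (step2 i) then show ?case using f1[OF latCH[OF that], of "i - 1" 0 0] by (simp add: lat_comp algebra_simps)
  qed
  have f2n: "f (lat 0 n 0 x) = f x + n * \<chi>2" if "x \<in> CH" for n x
  proof (induction n rule: int_induct[where k = 0])
    case base then show ?case by (simp add: lat_0)
  next
    case (step1 i) then show ?case using f2[OF latCH[OF that], of 0 i 0] by (simp add: lat_comp algebra_simps)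
  next
    case (step2 i) then show ?case using f2[OF latCH[OF that], of 0 "i - 1" 0] by (simp add: lat_comp algebra_simps)
  qed
  have f3n: "f (lat 0 0 l x) = f x + l * \<chi>3" if "x \<in> CH" for l x
  proof (induction l rule: int_induct[where k = 0])
    case base then show ?case by (simp add: lat_0)
  next
    case (step1 i) then show ?case using f3[OF latCH[OF that], of 0 0 i] by (simp add: lat_comp algebra_simps)
  next
    case (step2 i) then show ?case using f3[OF latCH[OF that], of 0 0 "i - 1"] by (simp add: lat_comp algebra_simps)
  qed
  have f: "f (lat m n l x) = f x + m * \<chi>1 + n * \<chi>2 + l * \<chi>3" if "x \<in> CH" for m n l x
  proof -
    have "lat m n l x = lat m 0 0 (lat 0 n 0 (lat 0 0 l x))" by (simp add: lat_comp)
    then show ?thesis using that by (simp add: f1n f2n f3n latCH)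
  qed
  define o' :: c2 where "o' = (0, \<i>)"
  have oCH: "o' \<in> CH" by (simp add: o'_def CH_def)
  have "lat 0 1 0 (lat 1 0 0 o') = lat 1 1 (- r) o'" by (simp add: lat_comp)
  then have "f o' + \<chi>1 + \<chi>2 = f o' + \<chi>1 + \<chi>2 - r * \<chi>3"
    using f[OF oCH, of 1 1 "- r"] f1[OF oCH] f2[OF latCH[OF oCH], of 1 0 0] by simp
  then have x3: "\<chi>3 = 0" using r by simp
  have rel: "m * \<chi>1 + n * \<chi>2 = (m * n11 + n * n21) * \<chi>1 + (m * n12 + n * n22) * \<chi>2" for m n :: int
  proof -
    obtain l' where "dil 1 (lat m n 0 o') = lat (m * n11 + n * n21) (m * n12 + n * n22) l' (dil 1 o')"
      using dil_lat by blast
    then show ?thesis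
      using f[OF oCH, of m n 0] f[OF dilCH[OF oCH, of 1], of "m * n11 + n * n21" "m * n12 + n * n22" l']
        f0[OF oCH] f0[OF latCH[OF oCH], of m n 0] x3 by simp
  qed
  have e1: "(n11 - 1) * \<chi>1 + n12 * \<chi>2 = 0" and e2: "n21 * \<chi>1 + (n22 - 1) * \<chi>2 = 0"
    using rel[of 1 0] rel[of 0 1] by (simp_all add: algebra_simps)
  define \<beta> where "\<beta> = \<epsilon> / \<alpha>"
  have \<beta>: "\<alpha> * \<beta> = \<epsilon>" "\<beta> < 1" using \<alpha> eps by (auto simp: \<beta>_def)
  \<comment> \<open>The trace is the sum of the eigenvalues; obtained by applying \<open>N\<close> to one column at a time of
    the determinant \<open>\<Delta>\<close> of the eigenvectors.\<close>
  have tr: "n11 + n22 = \<alpha> + \<beta>"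
  proof -
    have "(\<alpha> + \<beta>) * \<Delta> = b1 * (\<alpha> * a2) - b2 * (\<alpha> * a1) + (\<beta> * b1) * a2 - (\<beta> * b2) * a1"
      by (simp add: \<Delta>_def algebra_simps)
    also have "\<dots> = (n11 + n22) * \<Delta>"
      unfolding a(2,3)[symmetric] b(2,3)[folded \<beta>_def, symmetric] by (simp add: \<Delta>_def algebra_simps)
    finally show ?thesis using \<Delta>_nz by simp
  qed
  have "real_of_int n11 * n22 - n12 * n21 = \<epsilon>" using det by (metis of_int_diff of_int_mult)
  then have d: "(real_of_int n11 - 1) * (n22 - 1) - n12 * n21 = (\<alpha> - 1) * (\<beta> - 1)"
    using tr \<beta>(1) by (simp add: algebra_simps)
  have "((real_of_int n11 - 1) * (n22 - 1) - n12 * n21) * \<chi>1 =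
     (n22 - 1) * ((n11 - 1) * \<chi>1 + n12 * \<chi>2) - n12 * (n21 * \<chi>1 + (n22 - 1) * \<chi>2)"
    "((real_of_int n11 - 1) * (n22 - 1) - n12 * n21) * \<chi>2 =
     (n11 - 1) * (n21 * \<chi>1 + (n22 - 1) * \<chi>2) - n21 * ((n11 - 1) * \<chi>1 + n12 * \<chi>2)"
    by (simp_all add: algebra_simps)
  then have "(\<alpha> - 1) * (\<beta> - 1) * \<chi>1 = 0" "(\<alpha> - 1) * (\<beta> - 1) * \<chi>2 = 0"
    unfolding d e1 e2 by simp_all
  then show ?thesis using \<alpha> \<beta>(2) x3 by simp
qed

text \<open>The theorem on the cover: the invariant functions are the values of \<open>e\<^sup>-\<^sup>f \<eta>\<close> on \<open>\<partial>\<^sub>x\<close> and \<open>\<partial>\<^sub>y\<close>,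
  the tangent vectors \<open>(1, 0)\<close> and \<open>(\<i>, 0)\<close>.\<close>

lemma no_invariant_potential:
  fixes \<theta> \<eta> :: "c2 \<Rightarrow> c2 \<Rightarrow> real"
  assumes lin: "\<And>x. x \<in> CH \<Longrightarrow> linear (\<theta> x)"
    and smooth: "\<And>v. smooth_on CH (\<lambda>x. \<theta> x v)" "\<And>v. smooth_on CH (\<lambda>x. \<eta> x v)"
    and closed: "\<And>x u v. x \<in> CH \<Longrightarrow> ext_d1 \<theta> x u v = 0"
    and inv\<theta>: "\<And>h h' x v. h \<in> gens \<Longrightarrow> x \<in> CH \<Longrightarrow> (h has_derivative h') (at x) \<Longrightarrow> \<theta> (h x) (h' v) = \<theta> x v"
    and inv\<eta>: "\<And>h h' x v. h \<in> gens \<Longrightarrow> x \<in> CH \<Longrightarrow> (h has_derivative h') (at x) \<Longrightarrow> \<eta> (h x) (h' v) = \<eta> x v"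
    and pos: "\<And>x. x \<in> CH \<Longrightarrow>
      0 < ext_d1 \<eta> x (1, 0) (\<i>, 0) - wedge11 (\<theta> x) (\<eta> x) (1, 0) (\<i>, 0)"
  shows False
proof -
  have der: "((\<lambda>x. \<phi> x v) has_derivative frechet_derivative (\<lambda>x. \<phi> x v) (at x)) (at x)"
    and cont': "continuous_on CH (\<lambda>x. frechet_derivative (\<lambda>x. \<phi> x v) (at x) u)"
    and cont: "continuous_on CH (\<lambda>x. \<phi> x v)"
    if "\<And>v. smooth_on CH (\<lambda>x. \<phi> x v)" "x \<in> CH" for \<phi> :: "c2 \<Rightarrow> c2 \<Rightarrow> real" and x u v
  proof -
    have C: "Ck_on 1 CH (\<lambda>x. \<phi> x v)" "Ck_on 0 CH (\<lambda>x. \<phi> x v)" using that(1) unfolding smooth_on_def by blast+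
    then show "((\<lambda>x. \<phi> x v) has_derivative frechet_derivative (\<lambda>x. \<phi> x v) (at x)) (at x)"
      using that(2) by (simp flip: frechet_derivative_works)
    show "continuous_on CH (\<lambda>x. frechet_derivative (\<lambda>x. \<phi> x v) (at x) u)"
      using C(1) unfolding One_nat_def Ck_on.simps by blast
    show "continuous_on CH (\<lambda>x. \<phi> x v)" using C(2) by simp
  qed
  have iCH: "(0, \<i>) \<in> CH" by (simp add: CH_def)
  have "\<exists>f. \<forall>x\<in>CH. (f has_derivative \<theta> x) (at x within CH)"
  proof (rule closed_one_form_exact_on_convex[where d = "\<lambda>v x. frechet_derivative (\<lambda>x. \<theta> x v) (at x)"])
    show "((\<lambda>x. \<theta> x v) has_derivative frechet_derivative (\<lambda>x. \<theta> x v) (at x)) (at x)" if "x \<in> CH" for x v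
      by (rule der[OF smooth(1) that])
    show "frechet_derivative (\<lambda>x. \<theta> x v) (at x) u = frechet_derivative (\<lambda>x. \<theta> x u) (at x) v" if "x \<in> CH" for x u v
      using closed[OF that, of u v] by (simp add: ext_d1_def)
    show "continuous_on CH (\<lambda>x. frechet_derivative (\<lambda>x. \<theta> x v) (at x) u)" for u v
      by (rule cont'[OF smooth(1) iCH])
  qed (rule convex_CH lin, assumption?)+
  then obtain f where f: "\<And>x. x \<in> CH \<Longrightarrow> (f has_derivative \<theta> x) (at x)"
    using open_CH by (metis at_within_open)
  have dil_der: "(dil 1 has_derivative (\<lambda>v. (of_real (of_int \<epsilon>) * fst v, of_real \<alpha> * snd v))) (at x)" for x
    unfolding dil_def split_beta by (auto intro!: derivative_eq_intros)
  have char: "\<exists>\<kappa>::real. \<forall>x\<in>CH. f (h x) = f x + \<kappa>"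
    if h: "h \<in> gens" "\<And>x. x \<in> CH \<Longrightarrow> (h has_derivative h') (at x)" for h h'
    using f convex_CH
  proof (rule primitive_character)
    show "h x \<in> CH" if "x \<in> CH" for x
      using bij[OF h(1)] that by (auto simp: bij_betw_def)
    show "\<theta> (h x) (h' v) = \<theta> x v" if "x \<in> CH" for x v
      using inv\<theta> h that by blast
  qed (use h in auto)
  have lat: "lat 1 0 0 = heis a1 b1 c1" "lat 0 1 0 = heis a2 b2 c2" "lat 0 0 1 = heis 0 0 (\<Delta> / r)"
    by (simp_all add: lat_def)
  have gens: "dil 1 \<in> gens" "lat 1 0 0 \<in> gens" "lat 0 1 0 \<in> gens" "lat 0 0 1 \<in> gens"
    by (auto simp: gens_def)
  obtain \<chi>0 \<chi>1 \<chi>2 \<chi>3 where chi: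
     "\<And>x. x \<in> CH \<Longrightarrow> f (lat 1 0 0 x) = f x + \<chi>1"
     "\<And>x. x \<in> CH \<Longrightarrow> f (lat 0 1 0 x) = f x + \<chi>2"
     "\<And>x. x \<in> CH \<Longrightarrow> f (lat 0 0 1 x) = f x + \<chi>3"
     "\<And>x. x \<in> CH \<Longrightarrow> f (dil 1 x) = f x + \<chi>0"
    using char[OF gens(1) dil_der]
      char[OF gens(2), unfolded lat, OF heis_has_derivative]
      char[OF gens(3), unfolded lat, OF heis_has_derivative]
      char[OF gens(4), unfolded lat, OF heis_has_derivative]
    unfolding lat by blast
  have chi0: "\<chi>1 = 0 \<and> \<chi>2 = 0 \<and> \<chi>3 = 0" by (rule lattice_character_trivial[OF chi])
  have finv: "f (h x) = f x" if "h \<in> {lat 1 0 0, lat 0 1 0, lat 0 0 1}" "x \<in> CH" for h x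
    using that(1) chi(1-3)[OF that(2)] chi0 by auto
  have \<eta>inv: "\<eta> (h x) (z, 0) = \<eta> x (z, 0)" if h: "h \<in> {lat 1 0 0, lat 0 1 0, lat 0 0 1}" and "x \<in> CH" for h x z
  proof -
    obtain A B C where hh: "h = heis A B C" using h lat by blast
    have "h \<in> gens" using h gens by auto
    then show ?thesis
      using inv\<eta>[OF _ \<open>x \<in> CH\<close> heis_has_derivative, of A B C "(z, 0)"] by (simp add: hh)
  qed
  \<comment> \<open>\<open>K 1\<close> and \<open>K \<i>\<close> are the components of \<open>e\<^sup>-\<^sup>f \<eta>\<close> along \<open>\<partial>\<^sub>x\<close> and \<open>\<partial>\<^sub>y\<close>.\<close>
  define K where "K = (\<lambda>z x. exp (- f x) * \<eta> x (z, 0))"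
  define K' where "K' = (\<lambda>z x v. exp (- f x) *
     (frechet_derivative (\<lambda>x. \<eta> x (z, 0)) (at x) v - \<theta> x v * \<eta> x (z, 0)))"
  have K: "(K z has_derivative K' z x) (at x)" if "x \<in> CH" for z x
    unfolding K_def K'_def
    by (auto intro!: derivative_eq_intros f der smooth that simp: fun_eq_iff algebra_simps)
  have contf: "continuous_on CH f"
    using f has_derivative_continuous continuous_at_imp_continuous_on by blast
  have contK': "continuous_on CH (\<lambda>x. K' z x v)" for z v
    unfolding K'_def
    by (intro continuous_intros contf cont'[OF smooth(2) iCH] cont[OF smooth(1) iCH] cont[OF smooth(2) iCH])
  have Kinv: "K z (h x) = K z x" if "h \<in> {lat 1 0 0, lat 0 1 0, lat 0 0 1}" "x \<in> CH" for h z x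
    using finv[OF that] \<eta>inv[OF that] by (simp add: K_def)
  show False
  proof (rule lattice_invariant_divergence_not_positive[of "K 1" "K' 1" "K \<i>" "K' \<i>" a1 b1 c1 a2 b2 c2 "\<Delta> / r"])
    show "b1 * a2 - b2 * a1 \<noteq> 0" using \<Delta>_nz by (simp add: \<Delta>_def)
    show "\<Delta> / r \<noteq> 0" using \<Delta>_nz r by simp
    fix x assume x: "x \<in> CH"
    have "K' \<i> x (1, 0) - K' 1 x (\<i>, 0)
        = exp (- f x) * (ext_d1 \<eta> x (1, 0) (\<i>, 0) - wedge11 (\<theta> x) (\<eta> x) (1, 0) (\<i>, 0))"
      by (simp add: K'_def ext_d1_def wedge11_def algebra_simps)
    then show "0 < K' \<i> x (1, 0) - K' 1 x (\<i>, 0)" using pos[OF x] by simp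
    show "(K 1 has_derivative K' 1 x) (at x)" "(K \<i> has_derivative K' \<i> x) (at x)"
      by (rule K[OF x])+
    show "K 1 (heis a1 b1 c1 x) = K 1 x" "K 1 (heis a2 b2 c2 x) = K 1 x"
      "K 1 (heis 0 0 (\<Delta> / r) x) = K 1 x" "K \<i> (heis 0 0 (\<Delta> / r) x) = K \<i> x"
      unfolding lat[symmetric] by (intro Kinv x; simp)+
  qed (rule contK')+
qed

text \<open>In a chart, \<open>\<omega>(\<partial>\<^sub>x, J \<partial>\<^sub>x) = g(J \<partial>\<^sub>x, J \<partial>\<^sub>x) > 0\<close>, and \<open>J \<partial>\<^sub>x = \<partial>\<^sub>y\<close>. So the pullbacks of \<open>\<theta>\<close> and of a
  potential \<open>\<eta>\<close> of \<open>\<omega>\<close> contradict \<open>no_invariant_potential\<close>.\<close>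

lemma no_d_theta_exact_lck_metric:
  assumes lck: "lck_metric_with_lee_form (quotient_atlas CH (transformation_group CH gens)) g \<theta>"
    and exact: "d_theta_exact (quotient_atlas CH (transformation_group CH gens)) \<theta> (fundamental_form g)"
  shows False
proof -
  let ?A = "quotient_atlas CH (transformation_group CH gens)"
  obtain \<eta> where \<eta>: "smooth_one_form ?A \<eta>"
    and ex: "\<And>\<kappa> x u v. \<kappa> \<in> ?A \<Longrightarrow> x \<in> chart_image \<kappa> \<Longrightarrow>
      fundamental_form g \<kappa> x u v = ext_d1 (\<eta> \<kappa>) x u v - wedge11 (\<theta> \<kappa> x) (\<eta> \<kappa> x) u v"
    using exact unfolding d_theta_exact_def by blast
  have \<theta>: "smooth_one_form ?A \<theta>"
    and cl: "\<And>\<kappa> x u v. \<kappa> \<in> ?A \<Longrightarrow> x \<in> chart_image \<kappa> \<Longrightarrow> ext_d1 (\<theta> \<kappa>) x u v = 0"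
    and pos: "\<And>\<kappa> x u. \<kappa> \<in> ?A \<Longrightarrow> x \<in> chart_image \<kappa> \<Longrightarrow> u \<noteq> 0 \<Longrightarrow> 0 < g \<kappa> x u u"
    using lck unfolding lck_metric_with_lee_form_def closed_one_form_def hermitian_metric_def by blast+
  have sheet: "sheet_chart U \<in> ?A" "x \<in> chart_image (sheet_chart U)" if "sheet U" "x \<in> U" for U x
    using that chart_image_sheet by (auto simp: quotient_atlas_eq)
  show False
  proof (rule no_invariant_potential[of "pullback \<theta>" "pullback \<eta>"])
    fix x u v assume "x \<in> CH"
    then obtain U where U: "sheet U" "x \<in> U" using sheet_exists by blast
    show "ext_d1 (pullback \<theta>) x u v = 0"
      using cl[OF sheet[OF U]] pullback_ext_d1[OF \<theta> U] by simp
  next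
    fix x assume "x \<in> CH"
    then obtain U where U: "sheet U" "x \<in> U" using sheet_exists by blast
    have "cstr (1, 0) = (\<i>, 0)" by (simp add: cstr_def)
    then have "0 < fundamental_form g (sheet_chart U) x (1, 0) (\<i>, 0)"
      using pos[OF sheet[OF U], of "(\<i>, 0)"] by (simp add: fundamental_form_def zero_prod_def)
    then show "0 < ext_d1 (pullback \<eta>) x (1, 0) (\<i>, 0)
        - wedge11 (pullback \<theta> x) (pullback \<eta> x) (1, 0) (\<i>, 0)"
      using ex[OF sheet[OF U]] pullback_ext_d1[OF \<eta> U] pullback_sheet[OF \<eta> U] pullback_sheet[OF \<theta> U]
      by simp
  qed (rule pullback_linear[OF \<theta>] pullback_smooth[OF \<theta>] pullback_smooth[OF \<eta>]
        pullback_invariant[OF \<theta>] pullback_invariant[OF \<eta>]; assumption)+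
qed

end

section \<open>The Inoue surfaces\<close>

lemma inoue_plus_data_unfolded:
  assumes "inoue_plus_data N \<alpha> a b c p q r"
  shows "inoue_data 1 (N$1$1) (N$1$2) (N$2$1) (N$2$2) p q r \<alpha> (a$1) (a$2) (b$1) (b$2) (c$1) (c$2)"
  using assms
  unfolding inoue_plus_data_def inoue_data_def real_mat_def map_matrix_def inoue_e_def inoue_shift_def
  by (simp add: det_2 vec_eq_iff forall_2 matrix_vector_mult_def vector_matrix_mult_def transpose_def
      sum_2 Let_def vector_2 ac_simps)

lemma inoue_minus_data_unfolded:
  assumes "inoue_minus_data N \<alpha> a b c p q r"
  shows "inoue_data (- 1) (N$1$1) (N$1$2) (N$2$1) (N$2$2) p q r \<alpha> (a$1) (a$2) (b$1) (b$2) (c$1) (c$2)"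
  using assms
  unfolding inoue_minus_data_def inoue_data_def real_mat_def map_matrix_def inoue_e_def inoue_shift_def
  by (simp add: det_2 vec_eq_iff forall_2 matrix_vector_mult_def vector_matrix_mult_def transpose_def
      sum_2 Let_def vector_2 ac_simps)

theorem proposition4p14:
  fixes N :: "int^2^2" and \<alpha> :: real and a b c :: "real^2" and p q r :: int
  shows "(inoue_plus_data N \<alpha> a b c p q r \<longrightarrow>
            \<not> (\<exists>g \<theta>. lck_metric_with_lee_form (inoue_plus \<alpha> a b c r) g \<theta> \<and>
                      d_theta_exact (inoue_plus \<alpha> a b c r) \<theta> (fundamental_form g)))
       \<and> (inoue_minus_data N \<alpha> a b c p q r \<longrightarrow>
            \<not> (\<exists>g \<theta>. lck_metric_with_lee_form (inoue_minus \<alpha> a b c r) g \<theta> \<and>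
                      d_theta_exact (inoue_minus \<alpha> a b c r) \<theta> (fundamental_form g)))"
proof (intro conjI impI notI; elim exE conjE)
  fix g \<theta>
  assume data: "inoue_plus_data N \<alpha> a b c p q r"
    and lck: "lck_metric_with_lee_form (inoue_plus \<alpha> a b c r) g \<theta>"
      "d_theta_exact (inoue_plus \<alpha> a b c r) \<theta> (fundamental_form g)"
  interpret inoue_data 1 "N$1$1" "N$1$2" "N$2$1" "N$2$2" p q r \<alpha> "a$1" "a$2" "b$1" "b$2" "c$1" "c$2"
    using data by (rule inoue_plus_data_unfolded)
  have "{g0_plus \<alpha>, g12 a b c 1, g12 a b c 2, g3 a b r} = gens"
    unfolding gens_def g0_plus_def g12_def g3_def dil_def lat_def heis_def \<Delta>_def
    by (intro arg_cong2[where f = insert] refl) (auto simp: fun_eq_iff complex_eq_iff)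
  then show False using no_d_theta_exact_lck_metric lck by (simp add: inoue_plus_def)
next
  fix g \<theta>
  assume data: "inoue_minus_data N \<alpha> a b c p q r"
    and lck: "lck_metric_with_lee_form (inoue_minus \<alpha> a b c r) g \<theta>"
      "d_theta_exact (inoue_minus \<alpha> a b c r) \<theta> (fundamental_form g)"
  interpret inoue_data "- 1" "N$1$1" "N$1$2" "N$2$1" "N$2$2" p q r \<alpha> "a$1" "a$2" "b$1" "b$2" "c$1" "c$2"
    using data by (rule inoue_minus_data_unfolded)
  have "{g0_minus \<alpha>, g12 a b c 1, g12 a b c 2, g3 a b r} = gens"
    unfolding gens_def g0_minus_def g12_def g3_def dil_def lat_def heis_def \<Delta>_def
    by (intro arg_cong2[where f = insert] refl) (auto simp: fun_eq_iff complex_eq_iff)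
  then show False using no_d_theta_exact_lck_metric lck by (simp add: inoue_minus_def)
qed

end
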